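(* Consider the perturbed switching system $$\begin{pmatrix}\dfrac{dx}{d\sigma}\\[2mm] \dfrac{dy}{d\sigma}\end{pmatrix}=\begin{cases}\begin{pmatrix}-y\\ x-\frac13y^3+\varepsilon(b_{12}y^2+b_{13}y^3)\end{pmatrix}, & y\ge0,\\[3mm] \begin{pmatrix}-y\\ x+\frac13y^3+\varepsilon(b_{22}y^2+b_{23}y^3)\end{pmatrix}, & y<0,\end{cases}$$ where $0<|\varepsilon|\ll1$ and $b=(b_{12},b_{13},b_{22},b_{23})\in\mathbb{R}^4$. At most one small-amplitude limit cycle can bifurcate from the origin (which is a center for $\varepsilon=0$), and this bound is tight.
   Context: Orbits of the switching system are obtained by concatenating, at crossings of the switching line $y=0$, orbit arcs of the upper vector field in $y\ge0$ and of the lower vector field in $y<0$. A limit cycle is a periodic orbit that is isolated in the set of periodic orbits. "At most one small-amplitude limit cycle can bifurcate from the origin" means: for every $b^*\in\mathbb{R}^4$ there exist a neighborhood $U$ of the origin in $\mathbb{R}^2$ and $\varepsilon_0>0$ such that for all $\varepsilon$ and $b$ with $0<|\varepsilon|<\varepsilon_0$ and $|b-b^*|<\varepsilon_0$ the system has at most one limit cycle surrounding the origin and contained in $U$. "This bound is tight" means: there exists $b^*\in\mathbb{R}^4$ such that for every neighborhood $U'$ of the origin and every $\eta>0$ there are $\varepsilon$ and $b$ with $0<|\varepsilon|<\eta$ and $|b-b^*|<\eta$ for which the system has a limit cycle surrounding the origin and contained in $U'$. *)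

theory Defs
  imports "HOL-Analysis.Analysis"
begin

text \<open>
  A planar switching system with switching line \<open>y = 0\<close> is given by two vector fields:
  \<open>f\<close> acts on \<open>y \<ge> 0\<close> and \<open>g\<close> acts on \<open>y < 0\<close>.
\<close>

definition upper_arc :: "(real \<times> real \<Rightarrow> real \<times> real) \<Rightarrow> (real \<Rightarrow> real \<times> real) \<Rightarrow> real \<Rightarrow> real \<Rightarrow> bool" where
  "upper_arc f \<gamma> s t \<longleftrightarrow>
     (\<forall>u\<in>{s..t}. (\<gamma> has_vector_derivative f (\<gamma> u)) (at u within {s..t}) \<and> snd (\<gamma> u) \<ge> 0)"

text \<open>
  The condition \<open>y < 0\<close> is imposed in the interior of the time interval only, since the end points
  of a maximal lower arc lie on the switching line. There \<open>g\<close> gives the one-sided derivative.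
\<close>

definition lower_arc :: "(real \<times> real \<Rightarrow> real \<times> real) \<Rightarrow> (real \<Rightarrow> real \<times> real) \<Rightarrow> real \<Rightarrow> real \<Rightarrow> bool" where
  "lower_arc g \<gamma> s t \<longleftrightarrow>
     (\<forall>u\<in>{s..t}. (\<gamma> has_vector_derivative g (\<gamma> u)) (at u within {s..t})) \<and>
     (\<forall>u\<in>{s<..<t}. snd (\<gamma> u) < 0)"

text \<open>
  The two kinds of arcs share the value of \<open>\<gamma>\<close> at a common time \<open>\<tau> i\<close>, so consecutive arcs of
  different kind can only meet on the switching line.
\<close>

definition switching_trajectory ::
  "(real \<times> real \<Rightarrow> real \<times> real) \<Rightarrow> (real \<times> real \<Rightarrow> real \<times> real) \<Rightarrow> (real \<Rightarrow> real \<times> real) \<Rightarrow> real \<Rightarrow> bool" where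
  "switching_trajectory f g \<gamma> T \<longleftrightarrow>
     (\<exists>(\<tau> :: nat \<Rightarrow> real) n. \<tau> 0 = 0 \<and> \<tau> n = T \<and>
        (\<forall>i<n. \<tau> i < \<tau> (Suc i) \<and>
           (upper_arc f \<gamma> (\<tau> i) (\<tau> (Suc i)) \<or> lower_arc g \<gamma> (\<tau> i) (\<tau> (Suc i)))))"

text \<open>Periodic orbits are point sets; the last conjunct excludes equilibria.\<close>

definition periodic_orbit ::
  "(real \<times> real \<Rightarrow> real \<times> real) \<Rightarrow> (real \<times> real \<Rightarrow> real \<times> real) \<Rightarrow> (real \<times> real) set \<Rightarrow> bool" where
  "periodic_orbit f g \<Gamma> \<longleftrightarrow>
     (\<exists>\<gamma> T. T > 0 \<and> switching_trajectory f g \<gamma> T \<and> \<gamma> 0 = \<gamma> T \<and>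
        \<Gamma> = \<gamma> ` {0..T} \<and> \<not> \<gamma> constant_on {0..T})"

definition limit_cycle ::
  "(real \<times> real \<Rightarrow> real \<times> real) \<Rightarrow> (real \<times> real \<Rightarrow> real \<times> real) \<Rightarrow> (real \<times> real) set \<Rightarrow> bool" where
  "limit_cycle f g \<Gamma> \<longleftrightarrow> periodic_orbit f g \<Gamma> \<and>
     (\<exists>V. open V \<and> \<Gamma> \<subseteq> V \<and> (\<forall>\<Gamma>'. periodic_orbit f g \<Gamma>' \<and> \<Gamma>' \<subseteq> V \<longrightarrow> \<Gamma>' = \<Gamma>))"

definition is_center ::
  "(real \<times> real \<Rightarrow> real \<times> real) \<Rightarrow> (real \<times> real \<Rightarrow> real \<times> real) \<Rightarrow> real \<times> real \<Rightarrow> bool" where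
  "is_center f g p \<longleftrightarrow>
     (\<exists>N. open N \<and> p \<in> N \<and> (\<forall>q\<in>N - {p}. \<exists>\<Gamma>. periodic_orbit f g \<Gamma> \<and> q \<in> \<Gamma> \<and> p \<in> inside \<Gamma>))"

text \<open>
  The parameter vector \<open>(b12, b13, b22, b23)\<close> lives in a nested product of \<open>real\<close>, whose library
  norm and distance are the Euclidean ones.
\<close>

type_synonym params = "real \<times> real \<times> real \<times> real"

definition upper_field :: "real \<Rightarrow> params \<Rightarrow> real \<times> real \<Rightarrow> real \<times> real" where
  "upper_field \<epsilon> = (\<lambda>(b12, b13, b22, b23) (x, y).
     (- y, x - 1/3 * y^3 + \<epsilon> * (b12 * y^2 + b13 * y^3)))"

definition lower_field :: "real \<Rightarrow> params \<Rightarrow> real \<times> real \<Rightarrow> real \<times> real" where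
  "lower_field \<epsilon> = (\<lambda>(b12, b13, b22, b23) (x, y).
     (- y, x + 1/3 * y^3 + \<epsilon> * (b22 * y^2 + b23 * y^3)))"

text \<open>A limit cycle surrounds the origin if the origin lies in a bounded component of its complement.\<close>

definition origin_limit_cycle :: "real \<Rightarrow> params \<Rightarrow> (real \<times> real) set \<Rightarrow> (real \<times> real) set \<Rightarrow> bool" where
  "origin_limit_cycle \<epsilon> b U \<Gamma> \<longleftrightarrow>
     limit_cycle (upper_field \<epsilon> b) (lower_field \<epsilon> b) \<Gamma> \<and> (0, 0) \<in> inside \<Gamma> \<and> \<Gamma> \<subseteq> U"

end

(*
  On the line y = 0 the two fields agree to first order, so switching trajectories are the solutions
  of one planar C^1 system x' = -y, y' = x + phi y. In polar coordinates a closed orbit near the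
  origin is the graph of a solution u of du/dt = F(u, t) on [-pi, pi] with u(-pi) = u(pi). Reflecting
  the lower half, u(t) and u(-t) solve two equations on [0, pi] that differ only in the coefficients
  (p1, q1) and (p2, q2), and gap u t = 1/u(-t) - 1/u(t) satisfies the linear equation
  gap' = kap * gap + src, where src is sin^3 * ((p1 - p2) + (q1 - q2) * u * sin) up to a positive weight.
  If two closed solutions a < b existed, the difference of their gaps would be driven by a
  term of size (q1 - q2) * (b - a) * sin^4, all other terms being smaller by a factor of the radius;
  it could not vanish at pi. If the two coefficient pairs coincide, every orbit is closed and none
  is isolated. For the lower bound, p1 - p2 = -eps*beta and q1 - q2 = eps make the gap at pi change
  sign between two radii of order beta.
*)
theory Submission
  imports Defs
begin

text \<open>Both \<open>p1 - p2\<close> and \<open>q1 - q2\<close> shrink with \<epsilon>, so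
  expanding the return map in r with mere order-of-magnitude remainders would not bound the cycles
  uniformly. All estimates are homogeneous instead: each error is at most a small fraction of the
  very difference that drives the main term, and one absolute radius serves all coefficients of
  modulus at most 1. Two regimes arise. Either \<open>p1 - p2\<close> dominates on the whole ball
  and no orbit closes, or it is at most of order \<open>\<bar>q1 - q2\<bar> * rad\<close>.
  Reciprocals of radii are used because \<open>F\<close> has a factor r^2. The derivative of 1 / u
  is free of it, so the term with \<open>p1 - p2\<close> depends on the radius only through a weight
  close to 1 and nearly cancels between two orbits. Isolation is meant among all periodic orbits,
  and these are images of arbitrary finite concatenations of arcs, possibly winding several times.
  Hence closed polar graphs and periodic orbits must be matched in both directions.\<close>

section \<open>Differential equations on the real line\<close>

lemma has_vector_derivative_glue:
  fixes f :: "real \<Rightarrow> 'a::real_normed_vector"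
  assumes "a \<le> b" "b \<le> c"
    and l: "\<And>t. t \<in> {a..b} \<Longrightarrow> (f has_vector_derivative D t) (at t within {a..b})"
    and r: "\<And>t. t \<in> {b..c} \<Longrightarrow> (f has_vector_derivative D t) (at t within {b..c})"
    and t: "t \<in> {a..c}"
  shows "(f has_vector_derivative D t) (at t within {a..c})"
proof -
  \<comment> \<open>Off a closed set the within-filter is \<open>bot\<close> and every derivative
    claim is vacuous, so both one-sided hypotheses can be used at every t.\<close>
  have off: "(f has_vector_derivative D t) (at t within S)" if "closed S" "t \<notin> S" for S
  proof -
    have "at t within S = bot"
      using that by (simp add: at_within_eq_bot_iff)
    then show ?thesis
      by (simp add: has_vector_derivative_def has_derivative_def bounded_linear_scaleR_left)
  qed
  have 1: "(f has_vector_derivative D t) (at t within {a..b})"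
    using l off by (cases "t \<in> {a..b}") auto
  have 2: "(f has_vector_derivative D t) (at t within {b..c})"
    using r off by (cases "t \<in> {b..c}") auto
  have "{a..c} = {a..b} \<union> {b..c}" using assms(1,2) by auto
  with 1 2 show ?thesis
    unfolding has_vector_derivative_def has_derivative_within
    by (simp add: at_within_union filterlim_sup)
qed

lemma has_vector_derivative_shift:
  fixes f :: "real \<Rightarrow> 'a::real_normed_vector"
  assumes "(f has_vector_derivative D) (at (t - s) within {a..b})"
  shows "((\<lambda>x. f (x - s)) has_vector_derivative D) (at t within {a+s..b+s})"
proof -
  have im: "(\<lambda>x. x - s) ` {a+s..b+s} = {a..b}"
    by (auto simp: image_def intro!: bexI[of _ "_ + s"])
  have 1: "((\<lambda>x. x - s) has_vector_derivative 1) (at t within {a+s..b+s})"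
    by (auto intro!: derivative_eq_intros)
  from vector_diff_chain_within[OF 1, of f D] assms
  show ?thesis by (simp add: im o_def)
qed

text \<open>Equal end values and equal prescribed derivatives let the translated copies join
  differentiably. The second conclusion leads each t back to a point s of one period, so that facts
  known on \<open>{a..b}\<close> transfer to the whole line.\<close>

lemma periodic_extension:
  fixes f :: "real \<Rightarrow> 'a::real_normed_vector"
  assumes ab: "a < b" and per: "f a = f b" "D a = D b"
    and d: "\<And>t. t \<in> {a..b} \<Longrightarrow> (f has_vector_derivative D t) (at t within {a..b})"
  obtains g where "\<And>t. t \<in> {a..b} \<Longrightarrow> g t = f t"
    and "\<And>t. \<exists>s\<in>{a..b}. \<exists>n::int. t = s + of_int n * (b - a) \<and> g t = f s \<and> (g has_vector_derivative D s) (at t)"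
proof -
  define T where "T = b - a"
  have T: "T > 0" using ab by (simp add: T_def)
  define n where "n t = \<lfloor>(t - a) / T\<rfloor>" for t
  define g where "g t = f (t - of_int (n t) * T)" for t
  define G where "G t = D (t - of_int (n t) * T)" for t
  have n: "a + of_int (n t) * T \<le> t" "t < a + of_int (n t) * T + T" for t
    using floor_correct[of "(t - a) / T"] T unfolding n_def[symmetric]
    by (simp_all add: field_simps)
  \<comment> \<open>The right end point of a period already has the next floor value; there
    \<open>per\<close> is used.\<close>
  have red: "g t = f (t - of_int k * T) \<and> G t = D (t - of_int k * T)"
    if "t \<in> {a + of_int k * T .. a + of_int k * T + T}" for t and k :: int
  proof (cases "t = a + of_int k * T + T")
    case True
    then have "n t = k + 1" using T unfolding n_def
      by (intro floor_unique) (auto simp: field_simps)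
    with True per show ?thesis by (simp add: g_def G_def T_def algebra_simps)
  next
    case False
    then have "n t = k" using T that unfolding n_def
      by (intro floor_unique) (auto simp: field_simps)
    then show ?thesis by (simp add: g_def G_def)
  qed
  have gd: "(g has_vector_derivative G t) (at t within {a + of_int k * T .. b + of_int k * T})"
    if t: "t \<in> {a + of_int k * T .. b + of_int k * T}" for t and k :: int
  proof -
    have "((\<lambda>x. f (x - of_int k * T)) has_vector_derivative D (t - of_int k * T))
        (at t within {a + of_int k * T .. b + of_int k * T})"
      by (rule has_vector_derivative_shift, rule d) (use t in auto)
    moreover have "G t = D (t - of_int k * T)" using red[of t k] t by (simp add: T_def)
    ultimately have "((\<lambda>x. f (x - of_int k * T)) has_vector_derivative G t)
        (at t within {a + of_int k * T .. b + of_int k * T})" by simp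
    moreover have "g x = f (x - of_int k * T)" if "x \<in> {a + of_int k * T .. b + of_int k * T}" for x
      using red[of x k] that by (simp add: T_def)
    ultimately show ?thesis
      using has_vector_derivative_transform[OF t, of g "\<lambda>x. f (x - of_int k * T)" "G t"] by simp
  qed
  have at: "(g has_vector_derivative G t) (at t)" for t
  proof -
    define k where "k = n t"
    \<comment> \<open>The point t may be the left end of copy k; gluing on copy k - 1 makes it
      interior.\<close>
    have 1: "(g has_vector_derivative G t) (at t within {a + of_int (k-1) * T .. b + of_int k * T})"
    proof (rule has_vector_derivative_glue[where b = "a + of_int k * T"])
      have e: "b + of_int (k - 1) * T = a + of_int k * T" by (simp add: T_def algebra_simps)
      show "(g has_vector_derivative G t) (at t within {a + of_int (k-1) * T .. a + of_int k * T})"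
        if "t \<in> {a + of_int (k-1) * T .. a + of_int k * T}" for t
        using gd[of t "k-1"] that by (simp only: e)
      show "(g has_vector_derivative G t) (at t within {a + of_int k * T .. b + of_int k * T})"
        if "t \<in> {a + of_int k * T .. b + of_int k * T}" for t
        using gd[OF that] .
      show "a + of_int (k-1) * T \<le> a + of_int k * T" "a + of_int k * T \<le> b + of_int k * T"
        using T ab by (simp_all add: algebra_simps)
      show "t \<in> {a + of_int (k-1) * T .. b + of_int k * T}"
        using n[of t] T unfolding k_def atLeastAtMost_iff by (simp add: T_def algebra_simps)
    qed
    have "t \<in> interior {a + of_int (k-1) * T .. b + of_int k * T}"
      using n[of t] T by (simp add: k_def T_def algebra_simps)
    with 1 show ?thesis by (simp only: at_within_interior)
  qed
  show ?thesis
  proof (rule that)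
    show "g t = f t" if "t \<in> {a..b}" for t
      using red[of t 0] that by (simp add: T_def)
    show "\<exists>s\<in>{a..b}. \<exists>n::int. t = s + of_int n * (b - a) \<and> g t = f s \<and> (g has_vector_derivative D s) (at t)" for t
      using n[of t] at[of t]
      by (intro bexI[of _ "t - of_int (n t) * T"] exI[of _ "n t"] conjI)
         (simp_all add: g_def G_def T_def)
  qed
qed

text \<open>A slope of at least c makes f unbounded in both directions, hence onto. This serves to
  pass from time to angle and from angle to time.\<close>

lemma global_inverse:
  fixes f :: "real \<Rightarrow> real"
  assumes d: "\<And>t. (f has_real_derivative f' t) (at t)" and c: "c > 0" and lo: "\<And>t. c \<le> f' t"
  obtains g where "\<And>x. f (g x) = x" "\<And>t. g (f t) = t" "strict_mono f"
    "\<And>x. (g has_real_derivative inverse (f' (g x))) (at x)"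
proof -
  have gr: "f y - f x \<ge> c * (y - x)" if xy: "x < y" for x y
  proof -
    obtain z where "f y - f x = (y - x) * f' z"
      using MVT2[OF xy, of f f'] d by blast
    with xy lo[of z] show ?thesis by (simp add: mult.commute mult_left_mono)
  qed
  have sm: "strict_mono f"
    using gr c by (intro strict_monoI) (smt (verit) mult_pos_pos)
  have cont: "continuous_on A f" for A
    using d by (meson DERIV_continuous_on DERIV_subset top_greatest)
  have ex: "\<exists>t. f t = x" for x
  proof -
    define K where "K = \<bar>x - f 0\<bar> / c + 1"
    have K: "K > 0" "c * K \<ge> \<bar>x - f 0\<bar>" using c by (auto simp: K_def field_simps)
    have "f (-K) \<le> x" "x \<le> f K" using gr[of 0 K] gr[of "-K" 0] K by auto
    then show ?thesis using IVT'[of f "-K" x K] cont K by auto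
  qed
  define g where "g x = (SOME t. f t = x)" for x
  have fg: "f (g x) = x" for x unfolding g_def by (rule someI_ex[OF ex])
  have gf: "g (f t) = t" for t using fg[of "f t"] sm by (metis strict_mono_eq)
  have cg: "isCont g x" for x
    using isCont_inverse_function[of 1 "g x" g f] gf d fg DERIV_isCont by (metis zero_less_one)
  have "(g has_real_derivative inverse (f' (g x))) (at x)" for x
    by (rule DERIV_inverse_function[where f = f and a = "x - 1" and b = "x + 1"])
       (use d fg cg lo[of "g x"] c in auto)
  with fg gf sm that show ?thesis by blast
qed

lemma global_antiderivative:
  fixes f :: "real \<Rightarrow> real"
  assumes "\<And>t. isCont f t"
  obtains F where "\<And>t. (F has_real_derivative f t) (at t)" "F c = d"
proof -
  obtain F where F: "\<And>t. (F has_real_derivative f t) (at t)"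
    using einterval_antiderivative[of "-\<infinity>" "\<infinity>" f] assms
    by (auto simp: has_real_derivative_iff_has_vector_derivative)
  show ?thesis
    by (rule that[of "\<lambda>t. F t - F c + d"]) (auto intro!: derivative_eq_intros F)
qed

text \<open>\<open>f t ^ 2 * exp (- 2 * k * t)\<close> is nonnegative and nonincreasing, so it stays
  0 to the right of c. Reflecting t gives the left side.\<close>

lemma gronwall_zero:
  fixes f :: "real \<Rightarrow> real"
  assumes d: "\<And>t. (f has_real_derivative f' t) (at t)"
    and b: "\<And>t. \<bar>f' t\<bar> \<le> k * \<bar>f t\<bar>" and z: "f c = 0"
  shows "f t = 0"
proof -
  have fw: "f t = 0" if d: "\<And>t. (f has_real_derivative f' t) (at t)"
    and b: "\<And>t. \<bar>f' t\<bar> \<le> k * \<bar>f t\<bar>" and z: "f c = 0" and le: "c \<le> t" for f f' c t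
  proof -
    have "f t ^ 2 * exp (- 2 * k * t) \<le> f c ^ 2 * exp (- 2 * k * c)"
    proof (rule DERIV_nonpos_imp_nonincreasing[OF le])
      fix x
      have "f x * f' x \<le> \<bar>f x\<bar> * \<bar>f' x\<bar>" by (metis abs_ge_self abs_mult)
      also have "\<dots> \<le> \<bar>f x\<bar> * (k * \<bar>f x\<bar>)" by (intro mult_left_mono b) auto
      also have "\<dots> = k * f x ^ 2" by (simp add: power2_eq_square)
      finally have 1: "(2 * f x * f' x - 2 * k * f x ^ 2) \<le> 0" by simp
      have 2: "(2 * f x * f' x - 2 * k * f x ^ 2) * exp (- 2 * k * x) \<le> 0"
        using 1 by (intro mult_nonpos_nonneg) auto
      show "\<exists>y. ((\<lambda>t. f t ^ 2 * exp (- 2 * k * t)) has_real_derivative y) (at x) \<and> y \<le> 0"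
      proof (intro exI conjI)
        show "((\<lambda>t. f t ^ 2 * exp (- 2 * k * t)) has_real_derivative
            (2 * f x * f' x - 2 * k * f x ^ 2) * exp (- 2 * k * x)) (at x)"
          by (auto intro!: derivative_eq_intros d simp: algebra_simps)
      qed (rule 2)
    qed
    with z have "f t ^ 2 * exp (- 2 * k * t) \<le> 0" by simp
    then show ?thesis by (simp add: mult_le_0_iff)
  qed
  show ?thesis
  proof (cases "c \<le> t")
    case True
    then show ?thesis using fw[OF d b z] by blast
  next
    case False
    have "((\<lambda>t. f (- t)) has_real_derivative - f' (- t)) (at t)" for t
      using DERIV_chain'[OF DERIV_minus[OF DERIV_ident] d, of t] by simp
    from fw[OF this, of "-c" "-t"] b z False show ?thesis by simp
  qed
qed

lemma small_gronwall:
  fixes f :: "real \<Rightarrow> real"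
  assumes d: "\<And>t. t \<in> {a..b} \<Longrightarrow> (f has_real_derivative f' t) (at t within {a..b})"
    and b: "\<And>t. t \<in> {a..b} \<Longrightarrow> \<bar>f' t\<bar> \<le> k * \<bar>f t\<bar> + m"
    and k: "0 \<le> k" "k * (b - a) \<le> 1/4" and c: "c \<in> {a..b}" and t: "t \<in> {a..b}"
  shows "\<bar>f t - f c\<bar> \<le> \<bar>f c\<bar> / 3 + 4/3 * (b - a) * m"
proof -
  have cont: "continuous_on {a..b} f" using d by (rule DERIV_continuous_on)
  obtain s where s: "s \<in> {a..b}" "\<And>x. x \<in> {a..b} \<Longrightarrow> \<bar>f x\<bar> \<le> \<bar>f s\<bar>"
    using continuous_attains_sup[of "{a..b}" "\<lambda>x. \<bar>f x\<bar>"] cont c by (force intro: continuous_intros)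
  define M where "M = \<bar>f s\<bar>"
  have m: "0 \<le> k * M + m" using b[OF s(1)] by (simp add: M_def)
  have 1: "\<bar>f x - f c\<bar> \<le> M / 4 + (b - a) * m" if x: "x \<in> {a..b}" for x
  proof -
    have "norm (f x - f c) \<le> (k * M + m) * norm (x - c)"
    proof (rule field_differentiable_bound[OF _ d _ x c])
      fix z assume z: "z \<in> {a..b}"
      have "k * \<bar>f z\<bar> \<le> k * M" using s(2)[OF z] k by (simp add: M_def mult_left_mono)
      with b[OF z] show "norm (f' z) \<le> k * M + m" by simp
    qed auto
    also have "\<dots> \<le> (k * M + m) * (b - a)"
      using x c m by (intro mult_left_mono) auto
    also have "\<dots> = (k * (b - a)) * M + (b - a) * m" by (simp add: algebra_simps)
    also have "\<dots> \<le> 1/4 * M + (b - a) * m" using k by (intro add_right_mono mult_right_mono) (auto simp: M_def)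
    finally show ?thesis by simp
  qed
  have "M \<le> \<bar>f c\<bar> + M / 4 + (b - a) * m" using 1[OF s(1)] by (simp add: M_def)
  moreover have "4/3 * (b - a) * m = 4/3 * ((b - a) * m)" by simp
  ultimately show ?thesis using 1[OF t] by linarith
qed

text \<open>With \<open>L * (b - a)\<close> below 1 the integral operator contracts in the plain
  supremum norm, so a single fixed point covers the whole interval, on both sides of c.\<close>

lemma picard:
  fixes F :: "real \<Rightarrow> real \<Rightarrow> real"
  assumes cont: "continuous_on UNIV (\<lambda>(x, t). F x t)"
    and lip: "\<And>x y t. \<bar>F x t - F y t\<bar> \<le> L * \<bar>x - y\<bar>"
    and L: "0 \<le> L" "L * (b - a) \<le> 1/4" and c: "c \<in> {a..b}"
  obtains u where "u c = x0"
    "\<And>t. t \<in> {a..b} \<Longrightarrow> (u has_real_derivative F (u t) t) (at t within {a..b})"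
proof -
  \<comment> \<open>Bounded continuous functions live on the whole line, so iterates are continued
    constantly beyond \<open>{a..b}\<close>.\<close>
  define cl where "cl t = min b (max a t)" for t :: real
  have clin: "cl t \<in> {a..b}" for t using c by (auto simp: cl_def)
  have clid: "cl t = t" if "t \<in> {a..b}" for t using that by (auto simp: cl_def)
  define I where "I u t = integral {a..t} (\<lambda>s. F (u s) s)" for u t
  \<comment> \<open>Integrating from a and subtracting the value at c covers t < c without oriented
    integrals.\<close>
  define Q where "Q u t = x0 + I u (cl t) - I u c" for u t
  have cF: "continuous_on S (\<lambda>s. F (u s) s)" if "continuous_on S u" for u S
  proof -
    have "continuous_on S (\<lambda>s. (u s, s))" by (intro continuous_intros that)
    from continuous_on_compose2[OF cont this] show ?thesis by simp
  qed
  have Id: "(I u has_real_derivative F (u t) t) (at t within {a..b})"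
    if "continuous_on {a..b} u" "t \<in> {a..b}" for u t
    unfolding I_def using integral_has_real_derivative[OF cF[OF that(1)] that(2)] .
  have Ic: "continuous_on {a..b} (I u)" if "continuous_on {a..b} u" for u
    using Id[OF that] by (rule DERIV_continuous_on)
  have Qb: "Q u \<in> bcontfun" if "continuous_on {a..b} u" for u
  proof -
    have 1: "continuous_on UNIV (\<lambda>t. I u (cl t))"
      by (rule continuous_on_compose2[OF Ic[OF that]])
         (use clin in \<open>auto simp: cl_def intro!: continuous_intros\<close>)
    have "bounded (I u ` {a..b})"
      using compact_continuous_image[OF Ic[OF that]] by (simp add: compact_imp_bounded)
    then obtain B where B: "\<forall>t\<in>{a..b}. norm (I u t) \<le> B" by (auto simp: bounded_iff)
    have "norm (Q u t) \<le> \<bar>x0\<bar> + 2 * B" for t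
      using bspec[OF B clin[of t]] bspec[OF B c] unfolding Q_def real_norm_def by linarith
    with 1 show ?thesis
      by (intro bcontfun_normI) (auto simp: Q_def[abs_def] intro!: continuous_intros)
  qed
  define P where "P w = Bcontfun (Q (apply_bcontfun w))" for w :: "real \<Rightarrow>\<^sub>C real"
  have P: "apply_bcontfun (P w) t = Q (apply_bcontfun w) t" for w t
    unfolding P_def by (subst Bcontfun_inverse) (auto intro!: Qb)
  have "\<exists>!w. P w = w"
  proof (rule banach_fix_type[of "1/2"])
    show "\<forall>v w. dist (P v) (P w) \<le> 1/2 * dist v w"
    proof (intro allI dist_bound)
      fix v w :: "real \<Rightarrow>\<^sub>C real" and t :: real
      define f where "f t = I v t - I w t" for t
      have fd: "(f has_real_derivative (F (v t) t - F (w t) t)) (at t within {a..b})" if "t \<in> {a..b}" for t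
        unfolding f_def[abs_def]
        by (intro DERIV_diff Id that) (rule continuous_on_apply_bcontfun)+
      have "norm (f (cl t) - f c) \<le> (L * dist v w) * norm (cl t - c)"
      proof (rule field_differentiable_bound[OF _ fd _ clin c])
        fix z
        have "L * \<bar>v z - w z\<bar> \<le> L * dist v w"
          using dist_bounded[of v z w] L by (intro mult_left_mono) (auto simp: dist_real_def)
        with lip[of "v z" z "w z"] show "norm (F (v z) z - F (w z) z) \<le> L * dist v w" by simp
      qed auto
      also have "\<dots> \<le> (L * dist v w) * (b - a)"
        using clin[of t] c L by (intro mult_left_mono) auto
      also have "\<dots> = (L * (b - a)) * dist v w" by simp
      also have "\<dots> \<le> 1/2 * dist v w" using L by (intro mult_right_mono) auto
      finally show "dist (P v t) (P w t) \<le> 1/2 * dist v w"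
        by (simp add: P Q_def dist_real_def f_def algebra_simps)
    qed
  qed auto
  then obtain w where w: "P w = w" by blast
  have we: "w t = Q (apply_bcontfun w) t" for t using P[of w t] w by simp
  show ?thesis
  proof (rule that)
    show "w c = x0" by (simp add: we[of c] Q_def clid[OF c])
    fix t assume t: "t \<in> {a..b}"
    have "((\<lambda>t. x0 + I w t - I w c) has_real_derivative F (w t) t) (at t within {a..b})"
      by (auto intro!: derivative_eq_intros Id t)
    then show "(w has_real_derivative F (w t) t) (at t within {a..b})"
      by (rule has_field_derivative_transform_within[OF _ zero_less_one t]) (simp add: we[of "_ :: real"] Q_def clid)
  qed
qed

text \<open>The constant \<open>3/8\<close> is the mean value of \<open>sin x ^ 4\<close>; it absorbs \<open>\<eta>\<close> and the contribution of \<open>\<kappa> f\<close>.\<close>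

lemma forced_linear_pos:
  fixes f :: "real \<Rightarrow> real"
  assumes d: "\<And>t. t \<in> {0..pi} \<Longrightarrow> (f has_real_derivative \<kappa> t * f t + g t) (at t within {0..pi})"
    and f0: "f 0 = 0" and A: "A > 0"
    and k: "\<And>t. t \<in> {0..pi} \<Longrightarrow> \<bar>\<kappa> t\<bar> \<le> 1/2000"
    and g: "\<And>t. t \<in> {0..pi} \<Longrightarrow> A * (sin t ^ 4 - 1/100) \<le> g t"
    and gb: "\<And>t. t \<in> {0..pi} \<Longrightarrow> \<bar>g t\<bar> \<le> 16 * A"
  shows "f pi > 0"
proof -
  have pi4: "pi < 4" using pi_less_4 .
  have bd: "\<bar>f t\<bar> \<le> 100 * A" if t: "t \<in> {0..pi}" for t
  proof -
    have "\<bar>f t - f 0\<bar> \<le> \<bar>f 0\<bar> / 3 + 4/3 * (pi - 0) * (16 * A)"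
    proof (rule small_gronwall[OF d])
      show "\<bar>\<kappa> t * f t + g t\<bar> \<le> 1/2000 * \<bar>f t\<bar> + 16 * A" if "t \<in> {0..pi}" for t
      proof -
        have "\<bar>\<kappa> t * f t\<bar> \<le> 1/2000 * \<bar>f t\<bar>"
          unfolding abs_mult by (intro mult_right_mono k that) auto
        with gb[OF that] show ?thesis by linarith
      qed
    qed (use pi4 t in auto)
    moreover have "4/3 * (pi - 0) * (16 * A) \<le> 4/3 * 4 * (16 * A)"
      using pi4 A by (intro mult_right_mono mult_left_mono) auto
    ultimately show ?thesis using f0 A by linarith
  qed
  \<comment> \<open>The subtracted term is A times an antiderivative of sin^4 - 7/100. The value
    7/100 exceeds the losses 1/100 in \<open>g\<close> and 100/2000 in
    \<open>\<kappa> t * f t\<close>, and it is below 3/8.\<close>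
  define S where "S t = f t - A * (3 * t / 8 - sin (2 * t) / 4 + sin (4 * t) / 32 - 7/100 * t)" for t
  have "S 0 < S pi"
  proof (rule DERIV_pos_imp_increasing_open[where f = S])
    show "0 < pi" by simp
    fix t assume t: "0 < t" "t < pi"
    have fd: "(f has_real_derivative \<kappa> t * f t + g t) (at t)"
      using d[of t] t by (simp add: at_within_Icc_at)
    have s4: "3/8 - cos (2*t) / 2 + cos (4*t) / 8 = sin t ^ 4"
    proof -
      have c2: "cos (2*t) = 1 - 2 * sin t ^ 2" by (simp add: cos_double_sin)
      have c4: "cos (4*t) = 2 * cos (2*t) ^ 2 - 1" using cos_double_cos[of "2*t"] by simp
      have "sin t ^ 4 = (sin t ^ 2) ^ 2" by simp
      then show ?thesis unfolding c4 c2 by (simp add: power2_diff power_mult_distrib diff_divide_distrib add_divide_distrib)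
    qed
    have "(S has_real_derivative (\<kappa> t * f t + g t) - A * (3/8 - cos (2*t) / 2 + cos (4*t) / 8 - 7/100)) (at t)"
      unfolding S_def[abs_def]
      by (auto intro!: derivative_eq_intros fd)
    then have "(S has_real_derivative \<kappa> t * f t + g t - A * (sin t ^ 4 - 7/100)) (at t)"
      by (simp only: s4)
    moreover have "\<bar>\<kappa> t * f t\<bar> \<le> 1/2000 * (100 * A)"
      unfolding abs_mult using t by (intro mult_mono k bd) auto
    then have "0 < \<kappa> t * f t + g t - A * (sin t ^ 4 - 7/100)"
      using g[of t] t A by (simp add: algebra_simps)
    ultimately show "\<exists>y. (S has_real_derivative y) (at t) \<and> 0 < y" by blast
  next
    have "continuous_on {0..pi} f" using d by (rule DERIV_continuous_on)
    then show "continuous_on {0..pi} S"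
      unfolding S_def[abs_def] by (auto intro!: continuous_intros)
  qed
  moreover have "sin (2 * pi) = 0" "sin (4 * pi) = 0"
    using sin_npi[of 4] by auto
  moreover have "A * pi > 0" using A by simp
  ultimately show ?thesis using f0 by (simp add: S_def algebra_simps)
qed

section \<open>The system in polar coordinates\<close>

text \<open>Any sufficiently small radius would do.\<close>

abbreviation rad :: real where "rad \<equiv> 1/1000000"

definition polar_curve :: "(real \<Rightarrow> real) \<Rightarrow> (real \<times> real) set" where
  "polar_curve u = (\<lambda>t. (u t * cos t, u t * sin t)) ` {-pi..pi}"

text \<open>
  Both fields extend to the vector field of a single Lienard system \<open>x' = -y\<close>, \<open>y' = x + \<phi> y\<close>
  with \<open>\<phi>\<close> of class \<open>C\<^sup>1\<close>. The lower cubic coefficient is \<open>-q2\<close>, so that the reflection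
  \<open>y \<mapsto> -y\<close> combined with time reversal exchanges \<open>(p1, q1)\<close> and \<open>(p2, q2)\<close>.
  In polar coordinates the system reads \<open>r' = r^2 M sin \<theta>\<close>, \<open>\<theta>' = 1 + r M cos \<theta>\<close>,
  and \<open>F\<close> is the quotient of the two right-hand sides.
\<close>

locale lienard =
  fixes p1 q1 p2 q2 :: real
  assumes p1: "\<bar>p1\<bar> \<le> 1" and q1: "\<bar>q1\<bar> \<le> 1" and p2: "\<bar>p2\<bar> \<le> 1" and q2: "\<bar>q2\<bar> \<le> 1"
begin

definition up :: "real \<times> real \<Rightarrow> real \<times> real" where
  "up = (\<lambda>(x, y). (- y, x + p1 * y^2 + q1 * y^3))"

definition lo :: "real \<times> real \<Rightarrow> real \<times> real" where
  "lo = (\<lambda>(x, y). (- y, x + p2 * y^2 - q2 * y^3))"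

definition phi :: "real \<Rightarrow> real" where
  "phi y = p1 * (max y 0)^2 + q1 * (max y 0)^3 + p2 * (max (-y) 0)^2 + q2 * (max (-y) 0)^3"

definition h :: "real \<times> real \<Rightarrow> real \<times> real" where
  "h z = (- snd z, fst z + phi (snd z))"

text \<open>\<open>al t\<close> and \<open>be t\<close> are the coefficients of r^2 and r^3 of
  \<open>phi\<close> along the ray at angle t.\<close>

definition al :: "real \<Rightarrow> real" where
  "al t = p1 * (max (sin t) 0)^2 + p2 * (max (- sin t) 0)^2"

definition be :: "real \<Rightarrow> real" where
  "be t = q1 * (max (sin t) 0)^3 + q2 * (max (- sin t) 0)^3"

definition M :: "real \<Rightarrow> real \<Rightarrow> real" where "M r t = al t + r * be t"

definition N :: "real \<Rightarrow> real \<Rightarrow> real" where "N r t = 1 + cos t * (r * M r t)"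

definition F :: "real \<Rightarrow> real \<Rightarrow> real" where "F r t = sin t * (r^2 * M r t) / N r t"

text \<open>Closing up is kept as a separate condition. An interval centred at 0 lets t \<mapsto> -t
  exchange the two half turns.\<close>

definition polar_solution :: "(real \<Rightarrow> real) \<Rightarrow> bool" where
  "polar_solution u \<longleftrightarrow> (\<forall>t\<in>{-pi..pi}. 0 < u t \<and> u t < rad \<and>
     (u has_real_derivative F (u t) t) (at t within {-pi..pi}))"

text \<open>This and \<open>h_lo\<close> both include the line y = 0, where the two fields agree, so
  one-sided derivatives at switching times match.\<close>

lemma h_up: "snd z \<ge> 0 \<Longrightarrow> h z = up z"
  by (auto simp: h_def up_def phi_def case_prod_beta)

lemma h_lo: "snd z \<le> 0 \<Longrightarrow> h z = lo z"
  by (auto simp: h_def lo_def phi_def case_prod_beta max_def)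

lemma phi_polar: "r \<ge> 0 \<Longrightarrow> phi (r * sin t) = r^2 * M r t"
proof -
  assume r: "r \<ge> 0"
  have "max (r * sin t) 0 = r * max (sin t) 0" "max (- (r * sin t)) 0 = r * max (- sin t) 0"
    using r by (auto simp: max_def zero_le_mult_iff mult_le_0_iff)
  moreover have "p1 * (r*a)^2 + q1 * (r*a)^3 + p2 * (r*b)^2 + q2 * (r*b)^3
      = r^2 * (p1 * a^2 + p2 * b^2 + r * (q1 * a^3 + q2 * b^3))" for a b
    by algebra
  ultimately show ?thesis
    unfolding phi_def M_def al_def be_def by (simp only:)
qed

lemma al_be_bound: "\<bar>al t\<bar> \<le> 2" "\<bar>be t\<bar> \<le> 2"
proof -
  have s: "max (sin t) 0 \<le> 1" "max (- sin t) 0 \<le> 1" "0 \<le> max (sin t) 0" "0 \<le> max (- sin t) 0"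
    using sin_le_one[of t] sin_ge_minus_one[of t] by auto
  have b: "\<bar>p * x ^ n\<bar> \<le> 1" if "\<bar>p\<bar> \<le> 1" "0 \<le> x" "x \<le> 1" for p x :: real and n
    using mult_mono[OF that(1) power_le_one[OF that(2,3), of n]] that by (simp add: abs_mult)
  show "\<bar>al t\<bar> \<le> 2" "\<bar>be t\<bar> \<le> 2"
    unfolding al_def be_def
    by (intro order.trans[OF abs_triangle_ineq] order.trans[OF add_mono[OF b b]] p1 p2 q1 q2 s; simp)+
qed

lemma M_bound: "0 \<le> r \<Longrightarrow> r \<le> rad \<Longrightarrow> \<bar>M r t\<bar> \<le> 3"
proof -
  assume r: "0 \<le> r" "r \<le> rad"
  have "\<bar>r * be t\<bar> \<le> rad * 2" unfolding abs_mult using r al_be_bound by (intro mult_mono) auto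
  then show ?thesis using al_be_bound(1)[of t] unfolding M_def by linarith
qed

lemma N_bound:
  assumes "0 \<le> r" "r \<le> rad"
  shows "\<bar>N r t - 1\<bar> \<le> 3 * rad" "1/2 \<le> N r t" "N r t \<le> 2"
proof -
  have "\<bar>cos t * (r * M r t)\<bar> \<le> 1 * (rad * 3)"
    unfolding abs_mult using assms M_bound[OF assms, of t] by (intro mult_mono) auto
  then show "\<bar>N r t - 1\<bar> \<le> 3 * rad" "1/2 \<le> N r t" "N r t \<le> 2" unfolding N_def by auto
qed

lemma F_0 [simp]: "F 0 t = 0"
  by (simp add: F_def)

text \<open>\<open>F\<close> vanishes to second order at r = 0, so its Lipschitz constant is of
  order \<open>rad\<close>. The estimates give 44 * \<open>rad\<close>; the rounded value 1/10000,
  times the length 2 pi of a turn, is far below the 1/4 that \<open>picard\<close> and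
  \<open>small_gronwall\<close> require.\<close>

lemma F_lipschitz:
  assumes u: "0 \<le> u" "u \<le> rad" and v: "0 \<le> v" "v \<le> rad"
  shows "\<bar>F u t - F v t\<bar> \<le> 1/10000 * \<bar>u - v\<bar>"
proof -
  define P where "P r = r^2 * M r t" for r
  have n: "N u t \<ge> 1/2" "N v t \<ge> 1/2" "N v t \<le> 2" using N_bound u v by auto
  have P: "\<bar>P u - P v\<bar> \<le> 5 * rad * \<bar>u - v\<bar>"
  proof -
    have "\<bar>al t * (u + v)\<bar> \<le> 2 * (2 * rad)"
      unfolding abs_mult using u v al_be_bound by (intro mult_mono) auto
    moreover have "\<bar>be t * (u^2 + u * v + v^2)\<bar> \<le> 2 * (3 * rad^2)"
    proof -
      have "u^2 \<le> rad^2" "v^2 \<le> rad^2" "u * v \<le> rad^2"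
        unfolding power2_eq_square by (intro mult_mono u v order.refl; simp)+
      moreover have "0 \<le> u^2 + u * v + v^2" using u v by simp
      ultimately have "\<bar>u^2 + u * v + v^2\<bar> \<le> 3 * rad^2" by linarith
      then show ?thesis
        unfolding abs_mult by (intro mult_mono al_be_bound) auto
    qed
    moreover have "2 * (3 * rad^2) \<le> rad" by (simp add: power2_eq_square)
    ultimately have "\<bar>al t * (u + v) + be t * (u^2 + u * v + v^2)\<bar> \<le> 5 * rad"
      by linarith
    moreover have "P u - P v = (al t * (u + v) + be t * (u^2 + u * v + v^2)) * (u - v)"
      by (simp add: P_def M_def algebra_simps power2_eq_square)
    ultimately show ?thesis by (simp only: abs_mult) (intro mult_right_mono; simp)
  qed
  have N: "\<bar>N u t - N v t\<bar> \<le> 3 * \<bar>u - v\<bar>"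
  proof -
    have "\<bar>be t * (u + v)\<bar> \<le> 2 * (2 * rad)"
      unfolding abs_mult using u v al_be_bound by (intro mult_mono) auto
    then have "\<bar>al t + be t * (u + v)\<bar> \<le> 3" using al_be_bound(1)[of t] by linarith
    then have "\<bar>cos t * (al t + be t * (u + v))\<bar> \<le> 1 * 3"
      unfolding abs_mult by (intro mult_mono) auto
    moreover have "N u t - N v t = (cos t * (al t + be t * (u + v))) * (u - v)"
      by (simp add: N_def M_def algebra_simps)
    ultimately show ?thesis by (simp only: abs_mult) (intro mult_right_mono; simp)
  qed
  have Pv: "\<bar>P v\<bar> \<le> 3 * rad^2"
    unfolding P_def abs_mult using M_bound[OF v, of t] v
    by (subst mult.commute) (intro mult_mono; auto intro: power_mono)
  have "F u t - F v t = sin t * ((P u - P v) * N v t - P v * (N u t - N v t)) * (1 / N u t) * (1 / N v t)"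
    using n by (simp add: F_def P_def field_simps)
  then have "\<bar>F u t - F v t\<bar> = \<bar>sin t\<bar> * \<bar>(P u - P v) * N v t - P v * (N u t - N v t)\<bar> * (1 / N u t) * (1 / N v t)"
    using n by (simp add: abs_mult)
  also have "\<dots> \<le> 1 * (11 * rad * \<bar>u - v\<bar>) * 2 * 2"
  proof (intro mult_mono)
    have "\<bar>(P u - P v) * N v t\<bar> \<le> (5 * rad * \<bar>u - v\<bar>) * 2"
      unfolding abs_mult using n by (intro mult_mono P) auto
    moreover have "\<bar>P v * (N u t - N v t)\<bar> \<le> (3 * rad^2) * (3 * \<bar>u - v\<bar>)"
      unfolding abs_mult using n by (intro mult_mono N Pv) auto
    moreover have "(3 * rad^2) * (3 * \<bar>u - v\<bar>) \<le> rad * \<bar>u - v\<bar>"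
      by (simp add: power2_eq_square)
    ultimately show "\<bar>(P u - P v) * N v t - P v * (N u t - N v t)\<bar> \<le> 11 * rad * \<bar>u - v\<bar>"
      by linarith
  qed (use n in \<open>auto simp: field_simps\<close>)
  finally show ?thesis by linarith
qed

lemma continuous_al_be [continuous_intros]:
  "continuous_on S al" "continuous_on S be"
  unfolding al_def[abs_def] be_def[abs_def] by (intro continuous_intros)+

text \<open>Beyond \<open>rad\<close> the denominator \<open>N\<close> could vanish. Clamping the
  radius to \<open>{0..rad}\<close> gives a function that is defined, continuous and Lipschitz
  everywhere, as \<open>picard\<close> demands.\<close>

lemma continuous_F_clamp: "continuous_on UNIV (\<lambda>(x, t). F (max 0 (min rad x)) t)"
proof -
  have ab: "continuous_on UNIV (\<lambda>z::real\<times>real. al (snd z))" "continuous_on UNIV (\<lambda>z::real\<times>real. be (snd z))"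
    by (auto intro!: continuous_on_compose2[OF continuous_al_be(1)[of UNIV]]
        continuous_on_compose2[OF continuous_al_be(2)[of UNIV]] continuous_intros)
  have "N (max 0 (min rad x)) t \<noteq> 0" for x t
  proof -
    have "0 \<le> max 0 (min rad x)" "max 0 (min rad x) \<le> rad" by linarith+
    from N_bound(2)[OF this, of t] show ?thesis by linarith
  qed
  then show ?thesis
    unfolding case_prod_beta F_def
    by (intro continuous_intros ab) (auto simp: N_def M_def intro!: continuous_intros ab)
qed

text \<open>As \<open>F\<close> vanishes at r = 0 and has a tiny Lipschitz constant, a solution
  moves by at most a third of its initial value. It thus stays between 0 and \<open>rad\<close>,
  where clamping has no effect. The initial angle c is arbitrary because the center property asks
  for an orbit through any given point.\<close>

lemma polar_solution_exists:
  assumes c: "c \<in> {-pi..pi}" and r: "0 < r" "r \<le> rad / 2"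
  obtains u where "polar_solution u" "u c = r" "\<And>t. t \<in> {-pi..pi} \<Longrightarrow> \<bar>u t - r\<bar> \<le> r / 3"
proof -
  define G where "G x t = F (max 0 (min rad x)) t" for x t
  have lip: "\<bar>G x t - G y t\<bar> \<le> 1/10000 * \<bar>x - y\<bar>" for x y t
  proof -
    have "\<bar>G x t - G y t\<bar> \<le> 1/10000 * \<bar>max 0 (min rad x) - max 0 (min rad y)\<bar>"
      unfolding G_def by (rule F_lipschitz) auto
    also have "\<dots> \<le> 1/10000 * \<bar>x - y\<bar>" by (intro mult_left_mono) auto
    finally show ?thesis .
  qed
  have len: "1/10000 * (pi - (-pi)) \<le> 1/4" using pi_less_4 by simp
  obtain u where u: "u c = r"
    "\<And>t. t \<in> {-pi..pi} \<Longrightarrow> (u has_real_derivative G (u t) t) (at t within {-pi..pi})"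
    using picard[OF continuous_F_clamp[folded G_def] lip _ len c, of r] by auto
  have near: "\<bar>u t - r\<bar> \<le> r / 3" if t: "t \<in> {-pi..pi}" for t
  proof -
    have "\<bar>u t - u c\<bar> \<le> \<bar>u c\<bar> / 3 + 4/3 * (pi - (-pi)) * 0"
    proof (rule small_gronwall[OF u(2) _ _ len c t])
      show "\<bar>G (u t) t\<bar> \<le> 1/10000 * \<bar>u t\<bar> + 0" for t
        using lip[of "u t" t 0] by (simp add: G_def)
    qed auto
    then show ?thesis using u(1) r by simp
  qed
  have "polar_solution u"
    unfolding polar_solution_def
  proof (intro ballI conjI)
    fix t assume t: "t \<in> {-pi..pi}"
    show 1: "0 < u t" "u t < rad" using near[OF t] r by linarith+
    then have "G (u t) t = F (u t) t" by (simp add: G_def)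
    with u(2)[OF t] show "(u has_real_derivative F (u t) t) (at t within {-pi..pi})" by simp
  qed
  with u(1) near that show ?thesis by blast
qed


lemma polar_solutionD:
  assumes "polar_solution u" "t \<in> {-pi..pi}"
  shows "0 < u t" "u t < rad" "(u has_real_derivative F (u t) t) (at t within {-pi..pi})"
  using assms by (auto simp: polar_solution_def)

lemma F_periodic: "F r (t + 2 * pi * of_int n) = F r t"
proof -
  have "sin (t + 2 * pi * of_int n) = sin t" "cos (t + 2 * pi * of_int n) = cos t"
    by (simp_all add: sin_add cos_add sin_int_2pin cos_int_2pin)
  then show ?thesis
    by (simp add: M_def F_def N_def al_def be_def)
qed

lemma closed_polar_solution_extends:
  assumes u: "polar_solution u" and cl: "u (-pi) = u pi"
  obtains g where "\<And>t. t \<in> {-pi..pi} \<Longrightarrow> g t = u t"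
    and "\<And>t. 0 < g t" "\<And>t. g t < rad" "\<And>t. (g has_real_derivative F (g t) t) (at t)"
proof -
  \<comment> \<open>Both values are 0, since sin vanishes at both ends.\<close>
  have "F (u (-pi)) (-pi) = F (u pi) pi" by (simp add: F_def)
  moreover have "(u has_vector_derivative F (u t) t) (at t within {-pi..pi})" if "t \<in> {-pi..pi}" for t
    using polar_solutionD(3)[OF u that] by (simp add: has_real_derivative_iff_has_vector_derivative)
  moreover have "-pi < pi" using pi_gt_zero by linarith
  ultimately obtain g where g: "\<And>t. t \<in> {-pi..pi} \<Longrightarrow> g t = u t"
    "\<And>t. \<exists>s\<in>{-pi..pi}. \<exists>n::int. t = s + of_int n * (pi - (-pi)) \<and> g t = u s \<and>
        (g has_vector_derivative F (u s) s) (at t)"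
    using periodic_extension[of "-pi" pi u "\<lambda>t. F (u t) t"] cl by metis
  show ?thesis
  proof (rule that)
    fix t
    obtain s and n :: int where s: "s \<in> {-pi..pi}" "t = s + of_int n * (pi - (-pi))" "g t = u s"
      "(g has_vector_derivative F (u s) s) (at t)"
      using g(2) by blast
    then show "0 < g t" "g t < rad" using polar_solutionD[OF u s(1)] by simp_all
    have "t = s + 2 * pi * of_int n" using s(2) by (simp add: algebra_simps)
    then have "F (g t) t = F (u s) s" using s(3) F_periodic by simp
    then show "(g has_real_derivative F (g t) t) (at t)"
      using s(4) by (simp add: has_real_derivative_iff_has_vector_derivative)
  qed (use g(1) in auto)
qed

lemma isCont_M: "isCont g t \<Longrightarrow> isCont (\<lambda>t. M (g t) t) t"
proof -
  assume g: "isCont g t"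
  have "isCont al t" "isCont be t"
    using continuous_al_be[of UNIV] by (auto simp: continuous_on_eq_continuous_at)
  with g show ?thesis unfolding M_def by (intro continuous_intros)
qed

lemma isCont_N: "isCont g t \<Longrightarrow> isCont (\<lambda>t. N (g t) t) t"
  unfolding N_def by (intro continuous_intros isCont_M)

text \<open>When the angle moves with speed \<open>N\<close>, the radius has derivative
  \<open>F\<close> times \<open>N\<close>, where the denominator of \<open>F\<close> cancels. What
  remains are the polar equations of \<open>h\<close>.\<close>

lemma polar_chain:
  assumes g: "(g has_real_derivative F (g (\<theta> t)) (\<theta> t)) (at (\<theta> t))"
    and b: "0 < g (\<theta> t)" "g (\<theta> t) < rad"
    and th: "(\<theta> has_real_derivative N (g (\<theta> t)) (\<theta> t)) (at t)"
  defines "\<gamma> \<equiv> \<lambda>t. (g (\<theta> t) * cos (\<theta> t), g (\<theta> t) * sin (\<theta> t))"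
  shows "(\<gamma> has_vector_derivative h (\<gamma> t)) (at t)"
proof -
  let ?r = "g (\<theta> t)" and ?s = "sin (\<theta> t)" and ?c = "cos (\<theta> t)"
  let ?N = "N ?r (\<theta> t)" and ?M = "M ?r (\<theta> t)"
  have N: "?N \<noteq> 0" using N_bound(2)[of ?r "\<theta> t"] b by linarith
  have FN: "F ?r (\<theta> t) * ?N = ?s * (?r^2 * ?M)" using N by (simp add: F_def)
  have gd: "((\<lambda>t. g (\<theta> t)) has_real_derivative F ?r (\<theta> t) * ?N) (at t)"
    using DERIV_chain'[OF th g] by (simp add: mult.commute)
  have sc: "?s^2 + ?c^2 = 1" by simp
  have "((\<lambda>t. g (\<theta> t) * cos (\<theta> t)) has_real_derivative F ?r (\<theta> t) * ?N * ?c - ?r * (?s * ?N)) (at t)"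
    by (auto intro!: derivative_eq_intros gd th)
  moreover have "F ?r (\<theta> t) * ?N * ?c - ?r * (?s * ?N) = - (?r * ?s)"
    unfolding FN unfolding N_def by (simp add: algebra_simps power2_eq_square)
  ultimately have x: "((\<lambda>t. g (\<theta> t) * cos (\<theta> t)) has_real_derivative - (?r * ?s)) (at t)" by simp
  have "((\<lambda>t. g (\<theta> t) * sin (\<theta> t)) has_real_derivative F ?r (\<theta> t) * ?N * ?s + ?r * (?c * ?N)) (at t)"
    by (auto intro!: derivative_eq_intros gd th)
  moreover have "F ?r (\<theta> t) * ?N * ?s + ?r * (?c * ?N) = ?r * ?c + phi (?r * ?s)"
  proof -
    have "phi (?r * ?s) = ?r^2 * ?M" using phi_polar[of ?r "\<theta> t"] b by simp
    moreover have "F ?r (\<theta> t) * ?N * ?s + ?r * (?c * ?N) = ?r * ?c + ?r^2 * ?M * (?s^2 + ?c^2)"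
      unfolding FN unfolding N_def by algebra
    ultimately show ?thesis using sc by simp
  qed
  ultimately have y: "((\<lambda>t. g (\<theta> t) * sin (\<theta> t)) has_real_derivative ?r * ?c + phi (?r * ?s)) (at t)" by simp
  show ?thesis
    using has_vector_derivative_Pair[OF x[unfolded has_real_derivative_iff_has_vector_derivative]
      y[unfolded has_real_derivative_iff_has_vector_derivative]]
    by (simp add: \<gamma>_def h_def)
qed

lemma periodic_orbit_polar_curve:
  assumes u: "polar_solution u" and cl: "u (-pi) = u pi"
  shows "periodic_orbit up lo (polar_curve u)"
proof -
  obtain g where gu: "\<And>t. t \<in> {-pi..pi} \<Longrightarrow> g t = u t"
    and g0: "\<And>t. 0 < g t" and gR: "\<And>t. g t < rad"
    and gd: "\<And>t. (g has_real_derivative F (g t) t) (at t)"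
    using closed_polar_solution_extends[OF u cl] by blast
  have N: "1/2 \<le> N (g t) t" "N (g t) t \<le> 2" for t
    using N_bound[of "g t" t] g0[of t] gR[of t] by linarith+
  have iN: "isCont (\<lambda>t. inverse (N (g t) t)) t" for t
    using N(1)[of t] by (intro continuous_intros isCont_N DERIV_isCont[OF gd]) auto
  \<comment> \<open>Time as a function of the angle, starting at angle -pi. The lower half turn
    therefore comes first, and the inverse \<open>\<theta>\<close> gives the angle at a given
    time.\<close>
  obtain \<tau> where \<tau>: "\<And>t. (\<tau> has_real_derivative inverse (N (g t) t)) (at t)" "\<tau> (-pi) = 0"
    using global_antiderivative[OF iN] by blast
  have "1/2 \<le> inverse (N (g t) t)" for t
    using N[of t] by (simp add: field_simps)
  then obtain \<theta> where th: "\<And>x. \<tau> (\<theta> x) = x" "\<And>t. \<theta> (\<tau> t) = t" "strict_mono \<tau>"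
    and thd: "\<And>x. (\<theta> has_real_derivative inverse (inverse (N (g (\<theta> x)) (\<theta> x)))) (at x)"
    using global_inverse[OF \<tau>(1), of "1/2"] by (metis half_gt_zero zero_less_one)
  define \<gamma> where "\<gamma> t = (g (\<theta> t) * cos (\<theta> t), g (\<theta> t) * sin (\<theta> t))" for t
  have \<gamma>d: "(\<gamma> has_vector_derivative h (\<gamma> t)) (at t)" for t
    unfolding \<gamma>_def[abs_def]
    by (rule polar_chain) (use gd g0 gR thd in auto)
  have le: "\<theta> x \<le> t \<longleftrightarrow> x \<le> \<tau> t" "t \<le> \<theta> x \<longleftrightarrow> \<tau> t \<le> x" "\<theta> x < t \<longleftrightarrow> x < \<tau> t" "t < \<theta> x \<longleftrightarrow> \<tau> t < x" for x t
    using th(1)[of x] strict_mono_less_eq[OF th(3)] strict_mono_less[OF th(3)] by metis+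
  have \<tau>0: "0 < \<tau> 0" "\<tau> 0 < \<tau> pi"
    using \<tau>(2) strict_monoD[OF th(3), of "-pi" 0] strict_monoD[OF th(3), of 0 pi] by auto
  have snd_\<gamma>: "snd (\<gamma> t) = g (\<theta> t) * sin (\<theta> t)" for t by (simp add: \<gamma>_def)
  have lower: "lower_arc lo \<gamma> 0 (\<tau> 0)"
    unfolding lower_arc_def
  proof (intro conjI ballI)
    fix t assume t: "t \<in> {0..\<tau> 0}"
    then have "- pi \<le> \<theta> t" "\<theta> t \<le> 0" using le \<tau>(2) by auto
    then have "sin (\<theta> t) \<le> 0" using sin_ge_zero[of "- \<theta> t"] by simp
    then have "snd (\<gamma> t) \<le> 0" using g0[of "\<theta> t"] by (simp add: snd_\<gamma> mult_le_0_iff)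
    from h_lo[OF this] \<gamma>d[of t] show "(\<gamma> has_vector_derivative lo (\<gamma> t)) (at t within {0..\<tau> 0})"
      by (metis has_vector_derivative_at_within)
  next
    fix t assume t: "t \<in> {0<..<\<tau> 0}"
    then have "- pi < \<theta> t" "\<theta> t < 0" using le \<tau>(2) by auto
    then have "sin (\<theta> t) < 0" using sin_gt_zero[of "- \<theta> t"] by simp
    then show "snd (\<gamma> t) < 0" using g0[of "\<theta> t"] by (simp add: snd_\<gamma> mult_less_0_iff)
  qed
  have upper: "upper_arc up \<gamma> (\<tau> 0) (\<tau> pi)"
    unfolding upper_arc_def
  proof (intro ballI)
    fix t assume t: "t \<in> {\<tau> 0..\<tau> pi}"
    then have "0 \<le> \<theta> t" "\<theta> t \<le> pi" using le by auto
    then have "0 \<le> sin (\<theta> t)" by (rule sin_ge_zero)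
    then have s: "snd (\<gamma> t) \<ge> 0" using g0[of "\<theta> t"] by (simp add: snd_\<gamma> zero_le_mult_iff)
    from h_up[OF this] \<gamma>d[of t] s
    show "(\<gamma> has_vector_derivative up (\<gamma> t)) (at t within {\<tau> 0..\<tau> pi}) \<and> 0 \<le> snd (\<gamma> t)"
      by (metis has_vector_derivative_at_within)
  qed
  have "switching_trajectory up lo \<gamma> (\<tau> pi)"
    unfolding switching_trajectory_def
    by (rule exI[of _ "\<lambda>i. if i = 0 then 0 else if i = 1 then \<tau> 0 else \<tau> pi"], rule exI[of _ 2])
       (use \<tau>0 lower upper in \<open>auto simp: less_2_cases_iff\<close>)
  moreover have "\<gamma> 0 = \<gamma> (\<tau> pi)"
  proof -
    have "\<theta> 0 = - pi" using th(2)[of "-pi"] \<tau>(2) by simp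
    then show ?thesis using gu[of pi] gu[of "-pi"] cl th(2)[of pi] by (simp add: \<gamma>_def)
  qed
  moreover have "polar_curve u = \<gamma> ` {0..\<tau> pi}"
  proof -
    have "{-pi..pi} = \<theta> ` {0..\<tau> pi}"
    proof (intro equalityI subsetI)
      fix t assume "t \<in> {-pi..pi}"
      then show "t \<in> \<theta> ` {0..\<tau> pi}"
        using th(2)[of t] \<tau>(2) strict_mono_less_eq[OF th(3)]
        by (intro image_eqI[of _ _ "\<tau> t"]) (auto, metis)
    qed (use le \<tau>(2) in auto)
    moreover have "polar_curve u = (\<lambda>t. (g t * cos t, g t * sin t)) ` {-pi..pi}"
      unfolding polar_curve_def using gu by (intro image_cong) auto
    ultimately show ?thesis by (simp add: \<gamma>_def[abs_def] image_image)
  qed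
  moreover have "\<not> \<gamma> constant_on {0..\<tau> pi}"
  proof
    assume "\<gamma> constant_on {0..\<tau> pi}"
    \<comment> \<open>The points at angles 0 and pi lie on opposite sides of the origin.\<close>
    then have "\<gamma> (\<tau> 0) = \<gamma> (\<tau> pi)" using \<tau>0 unfolding constant_on_def by fastforce
    then have "g 0 = - g pi" using th(2) by (simp add: \<gamma>_def)
    with g0[of 0] g0[of pi] show False by simp
  qed
  ultimately show ?thesis
    unfolding periodic_orbit_def using \<tau>0 by (intro exI[of _ \<gamma>] exI[of _ "\<tau> pi"]) auto
qed

end

section \<open>Periodic orbits as polar graphs\<close>

lemma polar_representation:
  fixes z :: "real \<times> real"
  obtains t where "t \<in> {-pi..pi}" "z = (norm z * cos t, norm z * sin t)"
proof (cases "z = 0")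
  case True
  then show ?thesis using that[of 0] by (simp add: zero_prod_def)
next
  case False
  obtain x y where z: "z = (x, y)" by force
  define r where "r = norm z"
  have r: "r > 0" using False by (simp add: r_def)
  have r2: "r^2 = x^2 + y^2" by (simp add: r_def z norm_Pair)
  have "(x / r)^2 + (y / r)^2 = 1"
    using r unfolding power_divide add_divide_distrib[symmetric] r2[symmetric] by simp
  moreover have "\<exists>t\<in>{-pi..pi}. a = cos t \<and> b = sin t" if ab: "a^2 + b^2 = 1" for a b :: real
  proof (cases "b \<ge> 0")
    case True
    from sincos_total_pi[OF this ab] show ?thesis by force
  next
    case b: False
    then have "- b \<ge> 0" "a^2 + (- b)^2 = 1" using ab by auto
    from sincos_total_pi[OF this] obtain t where "0 \<le> t" "t \<le> pi" "a = cos t" "- b = sin t" by blast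
    then show ?thesis by (intro bexI[of _ "- t"]) auto
  qed
  ultimately obtain t where t: "t \<in> {-pi..pi}" "x / r = cos t" "y / r = sin t" by blast
  then have "z = (r * cos t, r * sin t)" using r by (auto simp: field_simps z)
  with that[OF t(1)] show ?thesis unfolding r_def by blast
qed

lemma angle_reduce:
  obtains n :: int where "t - 2 * pi * of_int n \<in> {-pi..pi}"
proof (rule that)
  show "t - 2 * pi * of_int \<lfloor>(t + pi) / (2 * pi)\<rfloor> \<in> {-pi..pi}"
    using floor_divide_lower[of "2 * pi" "t + pi"] floor_divide_upper[of "2 * pi" "t + pi"]
    by (simp add: algebra_simps)
qed

context lienard begin

text \<open>On each arc the acting field coincides with \<open>h\<close>, up to and including the
  end points. Consecutive arcs then glue, by induction on their number.\<close>

lemma switching_trajectory_deriv: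
  assumes "switching_trajectory up lo \<gamma> T" and t: "t \<in> {0..T}"
  shows "(\<gamma> has_vector_derivative h (\<gamma> t)) (at t within {0..T})"
proof -
  obtain \<tau> :: "nat \<Rightarrow> real" and n where \<tau>: "\<tau> 0 = 0" "\<tau> n = T"
    "\<And>i. i < n \<Longrightarrow> \<tau> i < \<tau> (Suc i)"
    "\<And>i. i < n \<Longrightarrow> upper_arc up \<gamma> (\<tau> i) (\<tau> (Suc i)) \<or> lower_arc lo \<gamma> (\<tau> i) (\<tau> (Suc i))"
    using assms(1) unfolding switching_trajectory_def by blast
  have arc: "(\<gamma> has_vector_derivative h (\<gamma> t)) (at t within {\<tau> i..\<tau> (Suc i)})"
    if i: "i < n" and t: "t \<in> {\<tau> i..\<tau> (Suc i)}" for i t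
    using \<tau>(4)[OF i]
  proof
    assume "upper_arc up \<gamma> (\<tau> i) (\<tau> (Suc i))"
    with t show ?thesis by (simp add: upper_arc_def h_up)
  next
    assume lo: "lower_arc lo \<gamma> (\<tau> i) (\<tau> (Suc i))"
    \<comment> \<open>\<open>lower_arc\<close> gives y < 0 only in the interior; y \<le> 0 at the
      end points follows by continuity.\<close>
    have cl: "closure {\<tau> i<..<\<tau> (Suc i)} = {\<tau> i..\<tau> (Suc i)}" using \<tau>(3)[OF i] by simp
    have "continuous_on {\<tau> i..\<tau> (Suc i)} \<gamma>"
      using lo unfolding lower_arc_def continuous_on_eq_continuous_within
      by (blast intro: has_vector_derivative_continuous)
    then have "continuous_on (closure {\<tau> i<..<\<tau> (Suc i)}) (\<lambda>t. snd (\<gamma> t))"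
      unfolding cl by (intro continuous_intros)
    moreover have "t \<in> closure {\<tau> i<..<\<tau> (Suc i)}" using t by (simp only: cl)
    ultimately have "snd (\<gamma> t) \<le> 0"
      by (rule continuous_le_on_closure) (use lo in \<open>auto simp: lower_arc_def intro: less_imp_le\<close>)
    with lo t show ?thesis by (simp add: lower_arc_def h_lo)
  qed
  have "0 \<le> \<tau> k \<and> (\<forall>t\<in>{0..\<tau> k}. (\<gamma> has_vector_derivative h (\<gamma> t)) (at t within {0..\<tau> k}))" if "k \<le> n" for k
    using that
  proof (induction k)
    case 0
    have "at (0::real) within {0} = bot" by (simp add: at_within_eq_bot_iff)
    then show ?case
      by (simp add: \<tau>(1) has_vector_derivative_def has_derivative_def bounded_linear_scaleR_left)
  next
    case (Suc k)
    then have "0 \<le> \<tau> k" "\<tau> k \<le> \<tau> (Suc k)" using \<tau>(3)[of k] by auto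
    moreover have "(\<gamma> has_vector_derivative h (\<gamma> t)) (at t within {0..\<tau> (Suc k)})"
      if "t \<in> {0..\<tau> (Suc k)}" for t
    proof (rule has_vector_derivative_glue[where D = "\<lambda>t. h (\<gamma> t)", OF calculation _ _ that])
      show "(\<gamma> has_vector_derivative h (\<gamma> t)) (at t within {0..\<tau> k})" if "t \<in> {0..\<tau> k}" for t
        using Suc that by simp
      show "(\<gamma> has_vector_derivative h (\<gamma> t)) (at t within {\<tau> k..\<tau> (Suc k)})"
        if "t \<in> {\<tau> k..\<tau> (Suc k)}" for t
        using arc[of k t] Suc.prems that by simp
    qed
    ultimately show ?case by simp
  qed
  from this[of n] \<tau>(2) t show ?thesis by simp
qed

text \<open>A continuous angle is obtained without covering spaces: it is the antiderivative of the
  angular speed \<open>w\<close> that starts at an angle of \<open>\<gamma> 0\<close>. That it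
  really is the angle is checked afterwards.\<close>

lemma polar_lift:
  assumes d: "\<And>t. (\<gamma> has_vector_derivative h (\<gamma> t)) (at t)"
    and n: "\<And>t. \<gamma> t \<noteq> 0" "\<And>t. norm (\<gamma> t) < rad"
  obtains \<theta> where "\<And>t. \<gamma> t = (norm (\<gamma> t) * cos (\<theta> t), norm (\<gamma> t) * sin (\<theta> t))"
    "\<And>t. (\<theta> has_real_derivative N (norm (\<gamma> t)) (\<theta> t)) (at t)"
    "\<And>t. ((\<lambda>t. norm (\<gamma> t)) has_real_derivative sin (\<theta> t) * ((norm (\<gamma> t))^2 * M (norm (\<gamma> t)) (\<theta> t))) (at t)"
proof -
  define x where "x t = fst (\<gamma> t)" for t
  define y where "y t = snd (\<gamma> t)" for t
  define r where "r t = norm (\<gamma> t)" for t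
  define w where "w t = 1 + x t * phi (y t) / (r t)^2" for t
  have r0: "r t > 0" for t using n by (simp add: r_def)
  have "(x t)^2 + (y t)^2 = (r t)^2" "r t = sqrt ((x t)^2 + (y t)^2)" for t
    by (simp_all add: r_def x_def y_def norm_prod_def)
  note r = r0 this
  have xd: "(x has_real_derivative - y t) (at t)" for t
    using bounded_linear.has_vector_derivative[OF bounded_linear_fst d[of t]]
    by (simp add: x_def[abs_def] y_def h_def has_real_derivative_iff_has_vector_derivative)
  have yd: "(y has_real_derivative x t + phi (y t)) (at t)" for t
    using bounded_linear.has_vector_derivative[OF bounded_linear_snd d[of t]]
    by (simp add: x_def y_def[abs_def] h_def has_real_derivative_iff_has_vector_derivative)
  have rd: "(r has_real_derivative y t * phi (y t) / r t) (at t)" for t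
  proof -
    have "((\<lambda>t. sqrt ((x t)^2 + (y t)^2)) has_real_derivative
        (2 * x t * (- y t) + 2 * y t * (x t + phi (y t))) * (inverse (sqrt ((x t)^2 + (y t)^2)) / 2)) (at t)"
      using r(1,2)[of t] by (auto intro!: derivative_eq_intros xd yd)
    moreover have "(2 * x t * (- y t) + 2 * y t * (x t + phi (y t))) * (inverse (sqrt ((x t)^2 + (y t)^2)) / 2)
        = y t * phi (y t) / r t"
      unfolding r(3)[symmetric] by (simp add: field_simps)
    moreover have "r = (\<lambda>t. sqrt ((x t)^2 + (y t)^2))" using r(3) by blast
    ultimately show ?thesis by simp
  qed
  have Xd: "((\<lambda>t. x t / r t) has_real_derivative - w t * (y t / r t)) (at t)" for t
  proof -
    have "((\<lambda>t. x t / r t) has_real_derivative ((- y t) * r t - x t * (y t * phi (y t) / r t)) / (r t * r t)) (at t)"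
      using r(1)[of t] by (intro DERIV_divide xd rd) simp
    moreover have "((- y t) * r t - x t * (y t * phi (y t) / r t)) / (r t * r t) = - w t * (y t / r t)"
      using r(1)[of t] by (simp add: w_def field_simps power2_eq_square)
    ultimately show ?thesis by simp
  qed
  have Yd: "((\<lambda>t. y t / r t) has_real_derivative w t * (x t / r t)) (at t)" for t
  proof -
    have "((\<lambda>t. y t / r t) has_real_derivative ((x t + phi (y t)) * r t - y t * (y t * phi (y t) / r t)) / (r t * r t)) (at t)"
      using r(1)[of t] by (intro DERIV_divide yd rd) simp
    moreover have "((x t + phi (y t)) * r t - y t * (y t * phi (y t) / r t)) / (r t * r t) = w t * (x t / r t)"
    proof -
      have "(x t + phi (y t)) * (r t)^2 - (y t)^2 * phi (y t) = x t * (r t)^2 + (x t)^2 * phi (y t)"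
        unfolding r(2)[symmetric] by (simp add: algebra_simps)
      then show ?thesis
        using r(1)[of t] by (simp add: w_def field_simps power2_eq_square)
    qed
    ultimately show ?thesis by simp
  qed
  have "isCont w t" for t
  proof -
    have c: "isCont x t" "isCont y t" "isCont r t" using xd yd rd DERIV_isCont by blast+
    then show ?thesis unfolding w_def[abs_def] phi_def
      using r(1)[of t] by (intro continuous_intros) auto
  qed
  obtain \<theta>0 where \<theta>0: "\<gamma> 0 = (r 0 * cos \<theta>0, r 0 * sin \<theta>0)"
    unfolding r_def by (rule polar_representation)
  obtain \<theta> where th: "\<And>t. (\<theta> has_real_derivative w t) (at t)" "\<theta> 0 = \<theta>0"
    using global_antiderivative[OF \<open>\<And>t. isCont w t\<close>] by blast
  \<comment> \<open>The inner product of the unit vectors \<gamma> / r and (cos \<theta>, sin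
    \<theta>). Both turn with speed \<open>w\<close>, so it keeps its initial value 1, and the
    squared distance 2 - 2 * E is 0.\<close>
  define E where "E t = x t / r t * cos (\<theta> t) + y t / r t * sin (\<theta> t)" for t
  have Ed: "(E has_real_derivative 0) (at t)" for t
    unfolding E_def[abs_def]
    by (rule derivative_eq_intros Xd Yd th refl)+ (simp add: algebra_simps)
  have E1: "E t = 1" for t
  proof -
    have "E t = E 0" using DERIV_isconst_all[of E] Ed by blast
    also have "E 0 = cos \<theta>0 ^ 2 + sin \<theta>0 ^ 2"
      using \<theta>0 r(1)[of 0] by (simp add: E_def th(2) x_def y_def power2_eq_square)
    finally show ?thesis by simp
  qed
  have xy: "x t = r t * cos (\<theta> t)" "y t = r t * sin (\<theta> t)" for t
  proof -
    have "(x t / r t)^2 + (y t / r t)^2 = 1"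
      using r(1,2)[of t] by (simp add: power_divide add_divide_distrib[symmetric])
    moreover have "(cos (\<theta> t))^2 + (sin (\<theta> t))^2 = 1" by simp
    moreover have "(x t / r t - cos (\<theta> t))^2 + (y t / r t - sin (\<theta> t))^2 =
        ((x t / r t)^2 + (y t / r t)^2) + ((cos (\<theta> t))^2 + (sin (\<theta> t))^2) - 2 * E t"
      by (simp add: E_def power2_eq_square algebra_simps)
    ultimately have "(x t / r t - cos (\<theta> t))^2 + (y t / r t - sin (\<theta> t))^2 = 0"
      using E1[of t] by linarith
    then have "x t / r t = cos (\<theta> t)" "y t / r t = sin (\<theta> t)"
      by (simp_all add: sum_power2_eq_zero_iff)
    then show "x t = r t * cos (\<theta> t)" "y t = r t * sin (\<theta> t)"
      using r(1)[of t] by (auto simp: field_simps)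
  qed
  have ph: "phi (y t) = (r t)^2 * M (r t) (\<theta> t)" for t
    using phi_polar[of "r t" "\<theta> t"] r(1)[of t] by (simp add: xy)
  have wN: "w t = N (r t) (\<theta> t)" for t
    using r(1)[of t] unfolding w_def N_def ph xy(1) by (simp add: field_simps power2_eq_square)
  have rr: "y t * phi (y t) / r t = sin (\<theta> t) * ((r t)^2 * M (r t) (\<theta> t))" for t
    using r(1)[of t] unfolding ph unfolding xy(2) by simp
  show ?thesis
  proof (rule that[unfolded r_def[symmetric]])
    show "\<gamma> t = (r t * cos (\<theta> t), r t * sin (\<theta> t))" for t
      using xy[of t] by (simp add: x_def y_def prod_eq_iff)
    show "(\<theta> has_real_derivative N (r t) (\<theta> t)) (at t)" for t
      using th(1)[of t] by (simp add: wN)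
    show "(r has_real_derivative sin (\<theta> t) * ((r t)^2 * M (r t) (\<theta> t))) (at t)" for t
      using rd[of t] by (simp add: rr)
  qed
qed

text \<open>An orbit that closes after k turns closes after one. The increments over single turns
  sum to 0 along k turns, so by continuity some increment is 0; two solutions that agree at one
  angle agree everywhere.\<close>

lemma global_polar_solution_periodic:
  assumes d: "\<And>t. (u has_real_derivative F (u t) t) (at t)"
    and u: "\<And>t. 0 < u t" "\<And>t. u t < rad" and k: "k > 0" "u (t0 + 2 * pi * real k) = u t0"
  shows "u (t + 2 * pi) = u t"
proof -
  define e where "e t = u (t + 2 * pi) - u t" for t
  have ed: "(e has_real_derivative F (u (t + 2 * pi)) t - F (u t) t) (at t)" for t
  proof -
    have "F (u (t + 2 * pi)) (t + 2 * pi) = F (u (t + 2 * pi)) t" using F_periodic[of _ t 1] by simp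
    then have "(u has_real_derivative F (u (t + 2 * pi)) t) (at (t + 2 * pi))"
      using d[of "t + 2 * pi"] by simp
    then have "((\<lambda>t. u (t + 2 * pi)) has_real_derivative F (u (t + 2 * pi)) t) (at t)"
      by (simp add: DERIV_shift)
    then show ?thesis unfolding e_def[abs_def] by (intro DERIV_diff d)
  qed
  have eb: "\<bar>F (u (t + 2 * pi)) t - F (u t) t\<bar> \<le> 1/10000 * \<bar>e t\<bar>" for t
    unfolding e_def by (rule F_lipschitz) (use u in \<open>auto intro: less_imp_le\<close>)
  have ec: "continuous_on S e" for S
    using DERIV_isCont[OF ed] by (intro continuous_at_imp_continuous_on) blast
  have sum0: "(\<Sum>j<k. e (t0 + 2 * pi * real j)) = 0"
  proof -
    have "(\<Sum>j<m. e (t0 + 2 * pi * real j)) = u (t0 + 2 * pi * real m) - u t0" for m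
      by (induction m) (simp_all add: e_def algebra_simps)
    then show ?thesis using k by simp
  qed
  have "\<exists>c. e c = 0"
  proof (rule ccontr)
    assume nz: "\<nexists>c. e c = 0"
    have "e a * e b > 0" for a b
    proof (rule ccontr)
      assume "\<not> e a * e b > 0"
      then have "e a \<le> 0 \<and> 0 \<le> e b \<or> e b \<le> 0 \<and> 0 \<le> e a"
        by (auto simp: zero_less_mult_iff not_less)
      moreover have "is_interval (range e)"
        using connected_continuous_image[OF ec[of UNIV]] by (simp add: is_interval_connected_1)
      ultimately have "0 \<in> range e" unfolding is_interval_1 by (metis rangeI)
      with nz show False by force
    qed
    then have "e t0 * (\<Sum>j<k. e (t0 + 2 * pi * real j)) > 0"
      unfolding sum_distrib_left using k(1) by (intro sum_pos) auto
    with sum0 show False by simp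
  qed
  then obtain c where "e c = 0" by blast
  from gronwall_zero[OF ed eb this, of t] show ?thesis by (simp add: e_def)
qed

text \<open>Near the origin the angle grows with speed at least 1/2, so the radius can be written as
  a function of the angle, and periodicity in time becomes periodicity in the angle.\<close>

theorem periodic_orbit_is_polar_curve:
  assumes po: "periodic_orbit up lo \<Gamma>" and sub: "\<Gamma> \<subseteq> ball 0 rad - {0}"
  obtains u where "polar_solution u" "u (-pi) = u pi" "\<Gamma> = polar_curve u"
proof -
  obtain \<gamma>0 T where T: "T > 0" "switching_trajectory up lo \<gamma>0 T" "\<gamma>0 0 = \<gamma>0 T" "\<Gamma> = \<gamma>0 ` {0..T}"
    using po unfolding periodic_orbit_def by blast
  obtain \<gamma> where \<gamma>0: "\<And>t. t \<in> {0..T} \<Longrightarrow> \<gamma> t = \<gamma>0 t"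
    and ex: "\<And>t. \<exists>s\<in>{0..T}. \<exists>n::int. t = s + of_int n * (T - 0) \<and> \<gamma> t = \<gamma>0 s \<and>
        (\<gamma> has_vector_derivative h (\<gamma>0 s)) (at t)"
    using periodic_extension[OF T(1,3), of "\<lambda>t. h (\<gamma>0 t)"] switching_trajectory_deriv[OF T(2)] T(3)
    by metis
  have \<gamma>d: "(\<gamma> has_vector_derivative h (\<gamma> t)) (at t)" for t using ex[of t] by auto
  have in\<Gamma>: "\<gamma> t \<in> \<Gamma>" for t using ex[of t] T(4) by auto
  then have nz: "\<gamma> t \<noteq> 0" "norm (\<gamma> t) < rad" for t using sub by fastforce+
  obtain \<theta> where th: "\<And>t. \<gamma> t = (norm (\<gamma> t) * cos (\<theta> t), norm (\<gamma> t) * sin (\<theta> t))"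
    "\<And>t. (\<theta> has_real_derivative N (norm (\<gamma> t)) (\<theta> t)) (at t)"
    "\<And>t. ((\<lambda>t. norm (\<gamma> t)) has_real_derivative sin (\<theta> t) * ((norm (\<gamma> t))^2 * M (norm (\<gamma> t)) (\<theta> t))) (at t)"
    using polar_lift[OF \<gamma>d nz] by blast
  have N: "1/2 \<le> N (norm (\<gamma> t)) (\<theta> t)" for t
    using N_bound(2)[of "norm (\<gamma> t)" "\<theta> t"] nz(2)[of t] by simp
  obtain g where g: "\<And>x. \<theta> (g x) = x" "\<And>t. g (\<theta> t) = t" "strict_mono \<theta>"
    "\<And>x. (g has_real_derivative inverse (N (norm (\<gamma> (g x))) (\<theta> (g x)))) (at x)"
    using global_inverse[OF th(2) _ N] by (metis half_gt_zero zero_less_one)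
  define u where "u x = norm (\<gamma> (g x))" for x
  have ud: "(u has_real_derivative F (u x) x) (at x)" for x
    using DERIV_chain'[OF g(4)[of x] th(3)[of "g x"]]
    by (simp add: u_def[abs_def] F_def g(1) divide_inverse mult.commute)
  have u: "0 < u x" "u x < rad" for x using nz by (simp_all add: u_def)
  have \<gamma>T: "\<gamma> T = \<gamma> 0" using \<gamma>0[of 0] \<gamma>0[of T] T(1,3) by simp
  then have "norm (\<gamma> T) = norm (\<gamma> 0)" by simp
  \<comment> \<open>The end points agree, so the angles differ by k full turns, with k > 0 because
    \<open>\<theta>\<close> increases. The parametrization may run around several times, so k need
    not be 1.\<close>
  have "(norm (\<gamma> 0) * cos (\<theta> T), norm (\<gamma> 0) * sin (\<theta> T)) = (norm (\<gamma> 0) * cos (\<theta> 0), norm (\<gamma> 0) * sin (\<theta> 0))"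
    using th(1)[of T] th(1)[of 0] unfolding \<gamma>T by metis
  then have "sin (\<theta> T) = sin (\<theta> 0) \<and> cos (\<theta> T) = cos (\<theta> 0)"
    using nz(1)[of 0] by simp
  then obtain k :: int where k: "\<theta> T = \<theta> 0 + 2 * pi * of_int k"
    using sin_cos_eq_iff by metis
  have "\<theta> 0 < \<theta> T" using g(3) T(1) by (simp add: strict_monoD)
  then have k0: "k > 0" using k by (simp add: zero_less_mult_iff)
  then have "u (\<theta> 0 + 2 * pi * real (nat k)) = u (\<theta> 0)" "nat k > 0"
    using k \<open>norm (\<gamma> T) = norm (\<gamma> 0)\<close> g(2) by (simp_all add: u_def flip: k)
  then have per: "u (x + 2 * pi) = u x" for x
    using global_polar_solution_periodic[OF ud u] by blast
  have pern: "u (x + 2 * pi * of_int n) = u x" for x and n :: int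
  proof -
    have nat: "u (x + 2 * pi * real m) = u x" for x m
    proof (induction m)
      case (Suc m)
      then show ?case using per[of "x + 2 * pi * real m"] by (simp add: algebra_simps)
    qed simp
    show ?thesis
    proof (cases "n \<ge> 0")
      case True
      then show ?thesis using nat[of x "nat n"] by simp
    next
      case False
      then show ?thesis using nat[of "x + 2 * pi * of_int n" "nat (- n)"] by simp
    qed
  qed
  have "\<Gamma> = polar_curve u"
  proof (intro equalityI subsetI)
    fix z assume "z \<in> \<Gamma>"
    then obtain t where "t \<in> {0..T}" "z = \<gamma>0 t" unfolding T(4) by blast
    with \<gamma>0 have t: "z = \<gamma> t" by simp
    obtain n :: int where n: "\<theta> t - 2 * pi * of_int n \<in> {-pi..pi}" by (rule angle_reduce)
    define s where "s = \<theta> t - 2 * pi * of_int n"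
    have s: "\<theta> t = s + 2 * pi * of_int n" by (simp add: s_def)
    have "sin (\<theta> t) = sin s" "cos (\<theta> t) = cos s"
      by (simp_all add: s sin_add cos_add sin_int_2pin cos_int_2pin)
    moreover have "norm (\<gamma> t) = u s"
    proof -
      have "u (\<theta> t) = u s" unfolding s by (rule pern)
      then show ?thesis by (simp add: u_def g(2))
    qed
    ultimately have "z = (u s * cos s, u s * sin s)" using th(1)[of t] t by simp
    then show "z \<in> polar_curve u" using n by (auto simp: polar_curve_def s_def)
  next
    fix z assume "z \<in> polar_curve u"
    then obtain t where "z = (u t * cos t, u t * sin t)" by (auto simp: polar_curve_def)
    then have "z = \<gamma> (g t)" using th(1)[of "g t"] g(1) by (simp add: u_def)
    then show "z \<in> \<Gamma>" using in\<Gamma> by simp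
  qed
  moreover have "polar_solution u"
    unfolding polar_solution_def using u ud by (auto intro: has_field_derivative_at_within)
  moreover have "u (-pi) = u pi" using per[of "-pi"] by simp
  ultimately show ?thesis using that by blast
qed

end

section \<open>Polar graphs as plane curves\<close>

lemma polar_curve_eq_iff:
  fixes r r' :: real
  assumes "(r * cos t, r * sin t) = (r' * cos t', r' * sin t')" "0 < r" "0 < r'"
  shows "r = r' \<and> cos t = cos t' \<and> sin t = sin t'"
proof -
  have nrm: "norm (a * cos s, a * sin s) = a" if "0 < a" for a s :: real
  proof -
    have "(a * cos s)^2 + (a * sin s)^2 = a^2 * ((sin s)^2 + (cos s)^2)" by (simp only: power_mult_distrib) algebra
    then show ?thesis using that by (simp add: norm_Pair)
  qed
  have "r = r'" using nrm[of r t] nrm[of r' t'] assms by simp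
  then show ?thesis using assms by simp
qed

lemma cos_sin_eq_interval:
  assumes "cos t = cos t'" "sin t = sin t'" "t \<in> {-pi..pi}" "t' \<in> {-pi..pi}"
  shows "t = t' \<or> t = pi \<and> t' = -pi \<or> t = -pi \<and> t' = pi"
proof -
  obtain n :: int where n: "t = t' + 2 * pi * of_int n" using sin_cos_eq_iff assms by metis
  have m2pi: "0 < 2 * pi" by simp
  have "2 * pi * of_int n \<le> 2 * pi * 1" "2 * pi * (-1) \<le> 2 * pi * of_int n" 
    using n assms(3,4) unfolding atLeastAtMost_iff by linarith+
  then have "of_int n \<le> (1::real)" "-1 \<le> (of_int n :: real)"
    by (simp_all only: mult_le_cancel_left_pos[OF m2pi])
  then have "n \<le> 1" "-1 \<le> n" by linarith+
  then consider "n = 0" | "n = 1" | "n = -1" by linarith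
  then show ?thesis using n assms by cases auto
qed

text \<open>A polar graph meets the positive x-axis only at angle 0, so the point set determines the
  initial radius.\<close>

lemma polar_curve_axis:
  assumes eq: "polar_curve u = polar_curve v"
    and u: "\<And>t. t \<in> {-pi..pi} \<Longrightarrow> 0 < u t" and v: "\<And>t. t \<in> {-pi..pi} \<Longrightarrow> 0 < v t"
  shows "u 0 = v 0"
proof -
  have "(u 0 * cos 0, u 0 * sin 0) \<in> polar_curve v"
    unfolding eq[symmetric] unfolding polar_curve_def by (rule image_eqI[OF refl]) simp
  then obtain t where t: "t \<in> {-pi..pi}" "(u 0 * cos 0, u 0 * sin 0) = (v t * cos t, v t * sin t)"
    unfolding polar_curve_def by blast
  from polar_curve_eq_iff[OF t(2)] u[of 0] v[OF t(1)] have c: "u 0 = v t" "cos 0 = cos t" "sin 0 = sin t"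
    by auto
  from cos_sin_eq_interval[OF c(2,3) _ t(1)] have "t = 0" by auto
  with c show ?thesis by simp
qed

text \<open>Star-shapedness replaces the Jordan curve theorem. Scaling the curve by factors at most
  1 gives a compact set \<open>A\<close>, by factors at least 1 a closed set \<open>B\<close>. They
  cover the plane and meet only in the curve, so the component of the origin is confined to
  \<open>A\<close>.\<close>

lemma origin_inside_polar_curve:
  assumes c: "continuous_on {-pi..pi} u" and pos: "\<And>t. t \<in> {-pi..pi} \<Longrightarrow> 0 < u t" and cl: "u (-pi) = u pi"
  shows "(0, 0) \<in> inside (polar_curve u)"
proof -
  define e where "e s t = (s * u t * cos t, s * u t * sin t)" for s t
  define A where "A = (\<lambda>(s, t). e s t) ` ({0..1} \<times> {-pi..pi})"
  define B where "B = {e s t | s t. 1 \<le> s \<and> t \<in> {-pi..pi}}"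
  have cmp: "compact ((\<lambda>(s, t). e s t) ` ({a..b} \<times> {-pi..pi}))" for a b
  proof (rule compact_continuous_image)
    have "continuous_on ({a..b} \<times> {-pi..pi}) (\<lambda>z. u (snd z))"
      by (rule continuous_on_compose2[OF c]) (auto intro!: continuous_intros)
    then show "continuous_on ({a..b} \<times> {-pi..pi}) (\<lambda>(s, t). e s t)"
      unfolding e_def case_prod_beta by (intro continuous_intros)
  qed (intro compact_Times compact_Icc)
  obtain t0 where t0: "t0 \<in> {-pi..pi}" "\<And>t. t \<in> {-pi..pi} \<Longrightarrow> u t0 \<le> u t"
    using continuous_attains_inf[OF compact_Icc _ c] by (metis atLeastAtMost_iff empty_iff pi_ge_zero neg_le_0_iff_le)
  define m where "m = u t0"
  have m: "m > 0" "\<And>t. t \<in> {-pi..pi} \<Longrightarrow> m \<le> u t" using t0 pos by (auto simp: m_def)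
  have ne: "norm (e s t) = s * u t" if "0 \<le> s" "t \<in> {-pi..pi}" for s t
  proof -
    have "(s * u t * cos t)^2 + (s * u t * sin t)^2 = (s * u t)^2 * ((sin t)^2 + (cos t)^2)"
      by (simp only: power_mult_distrib) algebra
    then show ?thesis using that pos[of t] by (simp add: norm_Pair e_def)
  qed
  have Bc: "closed B"
    unfolding closed_def
  proof (subst open_subopen, intro ballI)
    fix x assume x: "x \<in> - B"
    \<comment> \<open>Within distance 1 of x, the least radius \<open>m\<close> bounds the scaling
      factor, so there \<open>B\<close> coincides with a compact set.\<close>
    define K where "K = (\<lambda>(s, t). e s t) ` ({1..(norm x + 1) / m} \<times> {-pi..pi})"
    have "K \<subseteq> B"
    proof
      fix z assume "z \<in> K"
      then obtain s t where "z = e s t" "1 \<le> s" "t \<in> {-pi..pi}" by (auto simp: K_def)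
      then show "z \<in> B" unfolding B_def by blast
    qed
    have "ball x 1 \<inter> B \<subseteq> K"
    proof
      fix z assume z: "z \<in> ball x 1 \<inter> B"
      then obtain s t where st: "z = e s t" "1 \<le> s" "t \<in> {-pi..pi}" by (auto simp: B_def)
      have "norm z \<le> norm x + 1"
        using z norm_triangle_ineq2[of z x] by (auto simp: dist_norm norm_minus_commute)
      then have "s * u t \<le> norm x + 1" using ne[of s t] st by simp
      moreover have "s * m \<le> s * u t" using m(2)[OF st(3)] st by (intro mult_left_mono) auto
      ultimately have "s \<le> (norm x + 1) / m" using m(1) by (simp add: field_simps)
      with st show "z \<in> K" by (auto simp: K_def)
    qed
    moreover have "open (ball x 1 - K)"
      using cmp unfolding K_def by (intro open_Diff compact_imp_closed) auto
    ultimately show "\<exists>T. open T \<and> x \<in> T \<and> T \<subseteq> - B"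
      using x \<open>K \<subseteq> B\<close> by (intro exI[of _ "ball x 1 - K"]) auto
  qed
  have AB: "z \<in> A \<union> B" for z
  proof -
    obtain t where t: "t \<in> {-pi..pi}" "z = (norm z * cos t, norm z * sin t)" by (rule polar_representation)
    define s where "s = norm z / u t"
    have "s * u t = norm z" using pos[OF t(1)] by (simp add: s_def)
    then have "z = e s t" using t(2) by (simp add: e_def)
    moreover have "0 \<le> s" using pos[OF t(1)] by (simp add: s_def)
    ultimately show ?thesis
    proof (cases "s \<le> 1")
      case True
      with \<open>0 \<le> s\<close> t(1) \<open>z = e s t\<close> show ?thesis unfolding A_def by auto
    next
      case False
      then have "1 \<le> s" by simp
      with t(1) \<open>z = e s t\<close> have "z \<in> B" unfolding B_def by blast
      then show ?thesis by simp
    qed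
  qed
  have AiB: "A \<inter> B \<subseteq> polar_curve u"
  proof
    fix z assume z: "z \<in> A \<inter> B"
    then obtain s t where 1: "z = e s t" "0 \<le> s" "s \<le> 1" "t \<in> {-pi..pi}" by (auto simp: A_def)
    from z obtain s' t' where "z = e s' t'" "1 \<le> s'" "t' \<in> {-pi..pi}" by (auto simp: B_def)
    note st = 1 this
    have ee: "e s t = e s' t'" using st(1,5) by (rule subst)
    have "0 \<le> s'" using st(6) by simp
    have n: "s * u t = s' * u t'"
      using ne[OF st(2,4)] ne[OF \<open>0 \<le> s'\<close> st(7)] unfolding ee by (rule subst)
    have 0: "0 < s' * u t'" using st(6) pos[OF st(7)] by simp
    have "cos t = cos t' \<and> sin t = sin t'"
      using polar_curve_eq_iff[OF ee[unfolded e_def]] 0 unfolding n by blast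
    then have "u t = u t'" using cos_sin_eq_interval[of t t'] st(4,7) cl by metis
    then have "s = s'" using n pos[OF st(4)] by simp
    then have "s = 1" using st(3,6) by simp
    then show "z \<in> polar_curve u" using st(1,4) by (simp add: e_def polar_curve_def)
  qed
  have z: "(0, 0) \<notin> polar_curve u"
  proof
    assume "(0, 0) \<in> polar_curve u"
    then obtain t where t: "t \<in> {-pi..pi}" "(0, 0) = e 1 t" by (auto simp: polar_curve_def e_def)
    then show False using ne[of 1 t] pos[OF t(1)] by (simp flip: t(2) add: norm_Pair)
  qed
  define C where "C = connected_component_set (- polar_curve u) (0, 0)"
  have C: "connected C" "C \<subseteq> - polar_curve u" "(0, 0) \<in> C"
    using z by (auto simp: C_def connected_component_subset connected_component_refl)
  have "(0, 0) \<in> A" unfolding A_def by (rule image_eqI[of _ _ "(0, 0)"]) (auto simp: e_def)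
  have "A \<inter> C = {} \<or> B \<inter> C = {}"
  proof (rule connected_closedD[OF C(1) _ _ _ Bc])
    show "closed A" using cmp[of 0 1] by (simp add: A_def compact_imp_closed)
  qed (use AB AiB C(2) in blast)+
  then have "C \<subseteq> A" using \<open>(0, 0) \<in> A\<close> C(3) AB by auto
  then have "bounded C" using cmp[of 0 1] compact_imp_bounded bounded_subset unfolding A_def by blast
  with z show ?thesis by (simp add: inside_def C_def)
qed

context lienard begin

section \<open>The gap between the upper and the lower half orbit\<close>

text \<open>
  Put \<open>m\<^sub>i r = p\<^sub>i + q\<^sub>i r sin t\<close> and \<open>G\<^sub>i r = (sin t)^3 m\<^sub>i r / n\<^sub>i r\<close>. For \<open>t \<in> {0..pi}\<close> the reciprocals of \<open>u t\<close>
  and \<open>u (- t)\<close> have derivatives \<open>- G\<^sub>1 (u t)\<close> and \<open>- G\<^sub>2 (u (- t))\<close>. Here \<open>src r\<close> is \<open>G\<^sub>1 r - G\<^sub>2 r\<close>, and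
  \<open>kap r r'\<close> is the quotient of \<open>G\<^sub>2 r - G\<^sub>2 r'\<close> by \<open>1 / r' - 1 / r\<close>.
\<close>

definition n :: "real \<Rightarrow> real \<Rightarrow> real \<Rightarrow> real \<Rightarrow> real" where
  "n p q r t = 1 + cos t * ((sin t)^2 * (r * (p + q * (r * sin t))))"

definition gap :: "(real \<Rightarrow> real) \<Rightarrow> real \<Rightarrow> real" where
  "gap u t = 1 / u (- t) - 1 / u t"

definition A2 :: "real \<Rightarrow> real \<Rightarrow> real" where "A2 r t = r / n p2 q2 r t"

definition B2 :: "real \<Rightarrow> real \<Rightarrow> real" where "B2 r t = r * (p2 + q2 * (r * sin t)) / n p2 q2 r t"

definition kap :: "real \<Rightarrow> real \<Rightarrow> real \<Rightarrow> real" where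
  "kap r r' t = (sin t)^4 * (q2 * (A2 r t * A2 r' t)) - (sin t)^5 * cos t * (B2 r t * B2 r' t)"

definition wt :: "real \<Rightarrow> real \<Rightarrow> real" where "wt r t = 1 / (n p1 q1 r t * n p2 q2 r t)"

definition src :: "real \<Rightarrow> real \<Rightarrow> real" where
  "src r t = (sin t)^3 * ((p1 - p2) + (q1 - q2) * (r * sin t)) * wt r t"

lemma m_bound:
  assumes "0 \<le> r" "r \<le> rad" "\<bar>p\<bar> \<le> 1" "\<bar>q\<bar> \<le> 1"
  shows "\<bar>p + q * (r * sin t)\<bar> \<le> 2"
proof -
  have "\<bar>q * (r * sin t)\<bar> \<le> 1 * (rad * 1)"
    unfolding abs_mult using assms by (intro mult_mono) auto
  with assms(3) show ?thesis by linarith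
qed

lemma n_bound:
  assumes "0 \<le> r" "r \<le> rad" "\<bar>p\<bar> \<le> 1" "\<bar>q\<bar> \<le> 1"
  shows "9/10 \<le> n p q r t" "n p q r t \<le> 11/10"
proof -
  have s: "\<bar>(sin t)^2\<bar> \<le> 1" by (simp add: abs_square_le_1)
  have "\<bar>cos t * ((sin t)^2 * (r * (p + q * (r * sin t))))\<bar> \<le> 1 * (1 * (rad * 2))"
    unfolding abs_mult using assms s m_bound[OF assms, of t] by (intro mult_mono) auto
  then show "9/10 \<le> n p q r t" "n p q r t \<le> 11/10" unfolding n_def by linarith+
qed

lemma rm_lipschitz:
  assumes u: "0 \<le> u" "u \<le> rad" and v: "0 \<le> v" "v \<le> rad" and pq: "\<bar>p\<bar> \<le> 1" "\<bar>q\<bar> \<le> 1"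
  shows "\<bar>u * (p + q * (u * sin t)) - v * (p + q * (v * sin t))\<bar> \<le> 2 * \<bar>u - v\<bar>"
proof -
  have "\<bar>q * (sin t * (u + v))\<bar> \<le> 1 * (1 * (2 * rad))"
    unfolding abs_mult using u v pq by (intro mult_mono) auto
  then have "\<bar>p + q * (sin t * (u + v))\<bar> \<le> 2" using pq by linarith
  moreover have "u * (p + q * (u * sin t)) - v * (p + q * (v * sin t)) = (p + q * (sin t * (u + v))) * (u - v)"
    by (simp add: algebra_simps)
  ultimately show ?thesis by (simp only: abs_mult) (intro mult_right_mono; simp)
qed

lemma n_lipschitz:
  assumes u: "0 \<le> u" "u \<le> rad" and v: "0 \<le> v" "v \<le> rad" and pq: "\<bar>p\<bar> \<le> 1" "\<bar>q\<bar> \<le> 1"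
  shows "\<bar>n p q u t - n p q v t\<bar> \<le> 2 * \<bar>u - v\<bar>"
proof -
  have s: "\<bar>(sin t)^2\<bar> \<le> 1" by (simp add: abs_square_le_1)
  have "n p q u t - n p q v t = cos t * ((sin t)^2 * (u * (p + q * (u * sin t)) - v * (p + q * (v * sin t))))"
    by (simp add: n_def algebra_simps)
  then have "\<bar>n p q u t - n p q v t\<bar> \<le> 1 * (1 * (2 * \<bar>u - v\<bar>))"
    using s rm_lipschitz[OF assms, of t] by (simp only: abs_mult) (intro mult_mono; simp)
  then show ?thesis by simp
qed

lemma quotient_lipschitz:
  fixes a b c d :: real
  assumes c: "9/10 \<le> c" "c \<le> 11/10" and d: "9/10 \<le> d" "d \<le> 11/10"
    and b: "\<bar>b\<bar> \<le> 2" and ab: "\<bar>a - b\<bar> \<le> 2 * x" and cd: "\<bar>c - d\<bar> \<le> 2 * x"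
  shows "\<bar>a / c - b / d\<bar> \<le> 10 * x"
proof -
  have x: "0 \<le> x" using ab by linarith
  have "1 \<le> (c * d) * (100/81)" using mult_mono[OF c(1) d(1)] c d by simp
  then have cd1: "1 / (c * d) \<le> 100/81" using c d by (simp add: field_simps)
  have "a / c - b / d = ((a - b) * d - b * (c - d)) * (1 / (c * d))"
    using c d by (simp add: field_simps)
  then have "\<bar>a / c - b / d\<bar> = \<bar>(a - b) * d - b * (c - d)\<bar> * (1 / (c * d))"
    using c d by (simp add: abs_mult)
  also have "\<dots> \<le> (2 * x * (11/10) + 2 * (2 * x)) * (100/81)"
  proof (intro mult_mono cd1)
    have "\<bar>(a - b) * d\<bar> \<le> 2 * x * (11/10)" unfolding abs_mult using ab d by (intro mult_mono) auto
    moreover have "\<bar>b * (c - d)\<bar> \<le> 2 * (2 * x)" unfolding abs_mult using b cd by (intro mult_mono) auto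
    ultimately show "\<bar>(a - b) * d - b * (c - d)\<bar> \<le> 2 * x * (11/10) + 2 * (2 * x)" by linarith
  qed (use c d x in auto)
  also have "\<dots> \<le> 10 * x" using x by simp
  finally show ?thesis .
qed

lemma A2_B2_bound:
  assumes u: "0 \<le> u" "u \<le> rad"
  shows "\<bar>A2 u t\<bar> \<le> 4 * rad" "\<bar>B2 u t\<bar> \<le> 4 * rad"
proof -
  note n = n_bound[OF u p2 q2, of t]
  have i: "\<bar>1 / n p2 q2 u t\<bar> \<le> 2" using n by (simp add: field_simps)
  have "\<bar>u * (1 / n p2 q2 u t)\<bar> \<le> rad * 2"
    unfolding abs_mult[of u] using i u by (intro mult_mono) auto
  moreover have "A2 u t = u * (1 / n p2 q2 u t)" by (simp add: A2_def)
  ultimately show "\<bar>A2 u t\<bar> \<le> 4 * rad" by linarith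
  have "\<bar>(u * (p2 + q2 * (u * sin t))) * (1 / n p2 q2 u t)\<bar> \<le> (rad * 2) * 2"
    unfolding abs_mult[of "_ * _"] abs_mult[of u] using i u m_bound[OF u p2 q2, of t] by (intro mult_mono) auto
  moreover have "B2 u t = (u * (p2 + q2 * (u * sin t))) * (1 / n p2 q2 u t)" by (simp add: B2_def)
  ultimately show "\<bar>B2 u t\<bar> \<le> 4 * rad" by linarith
qed

lemma A2_B2_lipschitz:
  assumes u: "0 \<le> u" "u \<le> rad" and v: "0 \<le> v" "v \<le> rad"
  shows "\<bar>A2 u t - A2 v t\<bar> \<le> 10 * \<bar>u - v\<bar>" "\<bar>B2 u t - B2 v t\<bar> \<le> 10 * \<bar>u - v\<bar>"
proof -
  have "\<bar>v * (p2 + q2 * (v * sin t))\<bar> \<le> 1 * 2"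
    unfolding abs_mult[of v] using v m_bound[OF v p2 q2, of t] by (intro mult_mono) auto
  then show "\<bar>B2 u t - B2 v t\<bar> \<le> 10 * \<bar>u - v\<bar>"
    unfolding B2_def
    by (intro quotient_lipschitz n_bound rm_lipschitz n_lipschitz u v p2 q2) simp
  show "\<bar>A2 u t - A2 v t\<bar> \<le> 10 * \<bar>u - v\<bar>"
    unfolding A2_def
    by (intro quotient_lipschitz n_bound n_lipschitz u v p2 q2) (use v in auto)
qed

lemma sin_pow_bound: "\<bar>(sin t)^k\<bar> \<le> 1" for t :: real
  by (simp add: power_abs power_le_one)

lemma kap_bound:
  assumes u: "0 \<le> u" "u \<le> rad" and v: "0 \<le> v" "v \<le> rad"
  shows "\<bar>kap u v t\<bar> \<le> 1/2000"
proof -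
  have 1: "\<bar>(sin t)^4 * (q2 * (A2 u t * A2 v t))\<bar> \<le> 1 * (1 * ((4 * rad) * (4 * rad)))"
    unfolding abs_mult by (intro mult_mono sin_pow_bound[unfolded abs_mult] A2_B2_bound u v q2) auto
  have "\<bar>(sin t)^5 * cos t * (B2 u t * B2 v t)\<bar> \<le> 1 * 1 * ((4 * rad) * (4 * rad))"
    unfolding abs_mult by (intro mult_mono sin_pow_bound A2_B2_bound u v) auto
  with 1 show ?thesis unfolding kap_def by linarith
qed

text \<open>\<open>kap\<close> consists of products of two factors of order \<open>rad\<close>, so
  its Lipschitz constant keeps one factor \<open>rad\<close>. This makes the change of
  \<open>kap\<close> between two orbits negligible.\<close>

lemma kap_lipschitz:
  assumes "0 \<le> u" "u \<le> rad" "0 \<le> v" "v \<le> rad" "0 \<le> u'" "u' \<le> rad" "0 \<le> v'" "v' \<le> rad"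
  shows "\<bar>kap u v t - kap u' v' t\<bar> \<le> 100 * rad * (\<bar>u - u'\<bar> + \<bar>v - v'\<bar>)"
proof -
  define x where "x = \<bar>u - u'\<bar> + \<bar>v - v'\<bar>"
  have pr: "\<bar>a * b - a' * b'\<bar> \<le> 40 * rad * x"
    if "\<bar>a - a'\<bar> \<le> 10 * \<bar>u - u'\<bar>" "\<bar>b - b'\<bar> \<le> 10 * \<bar>v - v'\<bar>" "\<bar>b\<bar> \<le> 4 * rad" "\<bar>a'\<bar> \<le> 4 * rad" for a b a' b'
  proof -
    have 1: "\<bar>(a - a') * b\<bar> \<le> (10 * \<bar>u - u'\<bar>) * (4 * rad)"
      unfolding abs_mult by (intro mult_mono that) auto
    have 2: "\<bar>a' * (b - b')\<bar> \<le> (4 * rad) * (10 * \<bar>v - v'\<bar>)"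
      unfolding abs_mult by (intro mult_mono that) auto
    have "a * b - a' * b' = (a - a') * b + a' * (b - b')" by (simp add: algebra_simps)
    then have "\<bar>a * b - a' * b'\<bar> \<le> \<bar>(a - a') * b\<bar> + \<bar>a' * (b - b')\<bar>" by (simp only: abs_triangle_ineq)
    also have "\<dots> \<le> (10 * \<bar>u - u'\<bar>) * (4 * rad) + (4 * rad) * (10 * \<bar>v - v'\<bar>)" by (rule add_mono[OF 1 2])
    also have "\<dots> = 40 * rad * x" by (simp add: x_def)
    finally show ?thesis .
  qed
  have 1: "\<bar>(sin t)^4 * (q2 * (A2 u t * A2 v t - A2 u' t * A2 v' t))\<bar> \<le> 1 * (1 * (40 * rad * x))"
    unfolding abs_mult[of "_ ^ _"] abs_mult[of q2]
    by (intro mult_mono sin_pow_bound pr A2_B2_bound A2_B2_lipschitz assms q2) auto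
  have 2: "\<bar>(sin t)^5 * cos t * (B2 u t * B2 v t - B2 u' t * B2 v' t)\<bar> \<le> 1 * 1 * (40 * rad * x)"
    unfolding abs_mult[of "_ * cos _"] abs_mult[of "_ ^ _"]
    by (intro mult_mono sin_pow_bound pr A2_B2_bound A2_B2_lipschitz assms) auto
  have "kap u v t - kap u' v' t = (sin t)^4 * (q2 * (A2 u t * A2 v t - A2 u' t * A2 v' t))
      - (sin t)^5 * cos t * (B2 u t * B2 v t - B2 u' t * B2 v' t)"
    by (simp add: kap_def algebra_simps)
  moreover have "0 \<le> x" by (simp add: x_def)
  ultimately show ?thesis using 1 2 unfolding x_def[symmetric] by linarith
qed

lemma wt_bound:
  assumes u: "0 \<le> u" "u \<le> rad"
  shows "8/10 \<le> wt u t" "wt u t \<le> 13/10"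
proof -
  note n = n_bound[OF u p1 q1, of t] n_bound[OF u p2 q2, of t]
  have "(9/10) * (9/10) \<le> n p1 q1 u t * n p2 q2 u t" by (intro mult_mono n) (use n in auto)
  moreover have "n p1 q1 u t * n p2 q2 u t \<le> (11/10) * (11/10)" by (intro mult_mono n) (use n in auto)
  ultimately show "8/10 \<le> wt u t" "wt u t \<le> 13/10" unfolding wt_def by (simp_all add: field_simps)
qed

lemma wt_lipschitz:
  assumes u: "0 \<le> u" "u \<le> rad" and v: "0 \<le> v" "v \<le> rad"
  shows "\<bar>wt u t - wt v t\<bar> \<le> 50 * \<bar>u - v\<bar>"
proof -
  note n = n_bound[OF u p1 q1, of t] n_bound[OF u p2 q2, of t] n_bound[OF v p1 q1, of t] n_bound[OF v p2 q2, of t]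
  have 1: "\<bar>1 / n p q u t - 1 / n p q v t\<bar> \<le> 10 * \<bar>u - v\<bar>" if "\<bar>p\<bar> \<le> 1" "\<bar>q\<bar> \<le> 1" for p q
    by (intro quotient_lipschitz n_bound n_lipschitz u v that) auto
  have i: "\<bar>1 / n p q r t\<bar> \<le> 2" if "\<bar>p\<bar> \<le> 1" "\<bar>q\<bar> \<le> 1" "0 \<le> r" "r \<le> rad" for p q r
    using n_bound[OF that(3,4,1,2), of t] by (simp add: field_simps)
  have "wt u t - wt v t = (1 / n p1 q1 u t - 1 / n p1 q1 v t) * (1 / n p2 q2 u t)
      + (1 / n p1 q1 v t) * (1 / n p2 q2 u t - 1 / n p2 q2 v t)"
    by (simp add: wt_def algebra_simps)
  then have "\<bar>wt u t - wt v t\<bar> \<le> \<bar>(1 / n p1 q1 u t - 1 / n p1 q1 v t) * (1 / n p2 q2 u t)\<bar>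
      + \<bar>(1 / n p1 q1 v t) * (1 / n p2 q2 u t - 1 / n p2 q2 v t)\<bar>"
    by (simp only: abs_triangle_ineq)
  moreover have "\<bar>(1 / n p1 q1 u t - 1 / n p1 q1 v t) * (1 / n p2 q2 u t)\<bar> \<le> (10 * \<bar>u - v\<bar>) * 2"
    unfolding abs_mult by (intro mult_mono 1 i u v p1 q1 p2 q2) auto
  moreover have "\<bar>(1 / n p1 q1 v t) * (1 / n p2 q2 u t - 1 / n p2 q2 v t)\<bar> \<le> 2 * (10 * \<bar>u - v\<bar>)"
    unfolding abs_mult by (intro mult_mono 1 i u v p1 q1 p2 q2) auto
  ultimately show ?thesis by linarith
qed

text \<open>The derivative is the upper term at \<open>u t\<close> minus the lower term at
  \<open>u (- t)\<close>. Inserting the lower term at \<open>u t\<close> splits it into a change of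
  coefficients (\<open>src\<close>) and a change of radius, which is proportional to the
  gap.\<close>

lemma gap_deriv:
  assumes u: "polar_solution u" and t: "t \<in> {0..pi}"
  shows "(gap u has_real_derivative kap (u t) (u (- t)) t * gap u t + src (u t) t) (at t within {0..pi})"
proof -
  define s where "s = sin t"
  define c where "c = cos t"
  define a where "a = u t"
  define b where "b = u (- t)"
  define m1 where "m1 r = p1 + q1 * (r * s)" for r
  define m2 where "m2 r = p2 + q2 * (r * s)" for r
  define n1 where "n1 r = n p1 q1 r t" for r
  define n2 where "n2 r = n p2 q2 r t" for r
  have s0: "0 \<le> s" using t by (simp add: s_def sin_ge_zero)
  have tm: "t \<in> {-pi..pi}" "- t \<in> {-pi..pi}" using t by auto
  note ua = polar_solutionD[OF u tm(1), folded a_def] and ub = polar_solutionD[OF u tm(2), folded b_def]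
  have ns: "n1 a \<noteq> 0" "n2 a \<noteq> 0" "n2 b \<noteq> 0"
    using n_bound(1)[of a p1 q1 t] n_bound(1)[of a p2 q2 t] n_bound(1)[of b p2 q2 t] ua(1,2) ub(1,2) p1 q1 p2 q2
    by (auto simp: n1_def n2_def)
  have n12: "n1 r = 1 + c * (s^2 * (r * m1 r))" "n2 r = 1 + c * (s^2 * (r * m2 r))" for r
    by (simp_all add: n1_def n2_def n_def m1_def m2_def c_def s_def)
  \<comment> \<open>For t in \<open>{0..pi}\<close> only the coefficients with index 1 survive in
    \<open>M\<close> at t, and only those with index 2 at -t.\<close>
  have Ma: "M a t = s^2 * m1 a" using s0
    by (simp add: M_def al_def be_def s_def[symmetric] m1_def algebra_simps power2_eq_square power3_eq_cube)
  have Mb: "M b (- t) = s^2 * m2 b" using s0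
    by (simp add: M_def al_def be_def s_def[symmetric] m2_def algebra_simps power2_eq_square power3_eq_cube)
  have Fa: "F a t = a^2 * (s^3 * m1 a / n1 a)"
    by (simp add: F_def N_def Ma n12(1) s_def[symmetric] c_def[symmetric] mult_ac power2_eq_square power3_eq_cube)
  have Fb: "F b (- t) = - (b^2 * (s^3 * m2 b / n2 b))"
    by (simp add: F_def N_def Mb n12(2) s_def[symmetric] c_def[symmetric] mult_ac power2_eq_square power3_eq_cube)
  have da: "(u has_real_derivative F a t) (at t within {0..pi})"
    by (rule DERIV_subset[OF ua(3)]) auto
  have "(u has_real_derivative F b (- t)) (at (- t) within uminus ` {0..pi})"
    by (rule DERIV_subset[OF ub(3)]) auto
  moreover have "(uminus has_real_derivative - 1) (at t within {0..pi})"
    by (auto intro!: derivative_eq_intros)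
  ultimately have db: "((\<lambda>t. u (- t)) has_real_derivative - F b (- t)) (at t within {0..pi})"
    using DERIV_image_chain[of u "F b (- t)" uminus t "{0..pi}" "- 1"] by (simp add: o_def)
  have "(gap u has_real_derivative s^3 * m1 a / n1 a - s^3 * m2 b / n2 b) (at t within {0..pi})"
  proof -
    have "(gap u has_real_derivative (0 * u (- t) - 1 * - F b (- t)) / (u (- t) * u (- t)) - (0 * u t - 1 * F a t) / (u t * u t))
        (at t within {0..pi})"
      unfolding gap_def[abs_def]
      by (intro DERIV_diff DERIV_divide DERIV_const da db) (use ua(1) ub(1) in \<open>auto simp: a_def b_def\<close>)
    moreover have "(0 * u (- t) - 1 * - F b (- t)) / (u (- t) * u (- t)) - (0 * u t - 1 * F a t) / (u t * u t)
        = s^3 * m1 a / n1 a - s^3 * m2 b / n2 b"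
      unfolding a_def[symmetric] b_def[symmetric] Fa Fb using ua(1) ub(1) by (simp add: power2_eq_square)
    ultimately show ?thesis by simp
  qed
  moreover have "s^3 * m1 a / n1 a - s^3 * m2 b / n2 b = kap (u t) (u (- t)) t * gap u t + src (u t) t"
  proof -
    have 1: "s^3 * m1 a / n1 a - s^3 * m2 a / n2 a = src (u t) t"
    proof -
      have "s^3 * m1 a / n1 a - s^3 * m2 a / n2 a = s^3 * (m1 a * n2 a - m2 a * n1 a) * (1 / (n1 a * n2 a))"
        using ns by (simp add: field_simps)
      \<comment> \<open>The products of \<open>m1\<close> and \<open>m2\<close> cancel, which leaves
        a numerator that is exactly linear in the coefficient differences.\<close>
      also have "m1 a * n2 a - m2 a * n1 a = (p1 - p2) + (q1 - q2) * (a * s)"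
        unfolding n12 by (simp add: m1_def m2_def algebra_simps)
      finally show ?thesis by (simp add: src_def wt_def a_def s_def n1_def n2_def)
    qed
    have "s^3 * m2 a / n2 a - s^3 * m2 b / n2 b = s^3 * (m2 a * n2 b - m2 b * n2 a) / (n2 a * n2 b)"
      using ns by (simp add: field_simps)
    \<comment> \<open>The factor a - b equals a * b times the gap, which turns this term into
      \<open>kap\<close> times the gap.\<close>
    also have "m2 a * n2 b - m2 b * n2 a = (a - b) * (q2 * s - c * s^2 * m2 a * m2 b)"
      unfolding n12 by (simp add: m2_def algebra_simps power2_eq_square)
    also have "s^3 * ((a - b) * (q2 * s - c * s^2 * m2 a * m2 b)) / (n2 a * n2 b)
        = (s^4 * (q2 * (a / n2 a * (b / n2 b))) - s^5 * c * (a * m2 a / n2 a * (b * m2 b / n2 b))) * (1 / b - 1 / a)"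
    proof -
      have "1 / b - 1 / a = (a - b) / (a * b)" using ua(1) ub(1) by (simp add: field_simps)
      moreover have "s^4 = s^3 * s" "s^5 = s^3 * s^2" by (simp_all add: eval_nat_numeral)
      ultimately show ?thesis using ua(1) ub(1) ns by (simp add: field_simps)
    qed
    also have "\<dots> = kap (u t) (u (- t)) t * gap u t"
      by (simp add: kap_def gap_def A2_def B2_def a_def b_def c_def s_def n2_def m2_def)
    finally show ?thesis using 1 by linarith
  qed
  ultimately show ?thesis by simp
qed

end

section \<open>Sign of the gap and uniqueness of the closed solution\<close>

lemma sgn_real_facts: "x \<noteq> 0 \<Longrightarrow> \<bar>sgn x\<bar> = 1" "x \<noteq> 0 \<Longrightarrow> sgn x * x = \<bar>x\<bar>" for x :: real
  by (auto simp: sgn_if)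

context lienard begin

lemma polar_solution_bounds:
  assumes "polar_solution u" "t \<in> {0..pi}"
  shows "0 \<le> u t" "u t \<le> rad" "0 \<le> u (- t)" "u (- t) \<le> rad" "0 < u t"
  using polar_solutionD(1,2)[OF assms(1), of t] polar_solutionD(1,2)[OF assms(1), of "- t"] assms(2) by auto

lemma gap_0: "gap u 0 = 0"
  by (simp add: gap_def)

lemma kap_bound_solution:
  assumes "polar_solution u" "t \<in> {0..pi}"
  shows "\<bar>kap (u t) (u (- t)) t\<bar> \<le> 1/2000"
  by (rule kap_bound) (use polar_solution_bounds[OF assms] in auto)

lemma gap_bound:
  assumes u: "polar_solution u" and g: "\<And>t. t \<in> {0..pi} \<Longrightarrow> \<bar>src (u t) t\<bar> \<le> m" and t: "t \<in> {0..pi}"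
  shows "\<bar>gap u t\<bar> \<le> 6 * m"
proof -
  have "\<bar>gap u t - gap u 0\<bar> \<le> \<bar>gap u 0\<bar> / 3 + 4/3 * (pi - 0) * m"
  proof (rule small_gronwall[OF gap_deriv[OF u]])
    show "\<bar>kap (u t) (u (- t)) t * gap u t + src (u t) t\<bar> \<le> 1/2000 * \<bar>gap u t\<bar> + m" if "t \<in> {0..pi}" for t
    proof -
      have "\<bar>kap (u t) (u (- t)) t * gap u t\<bar> \<le> 1/2000 * \<bar>gap u t\<bar>"
        unfolding abs_mult by (intro mult_right_mono kap_bound_solution[OF u that]) auto
      with g[OF that] show ?thesis by linarith
    qed
  qed (use pi_less_4 t in auto)
  moreover have "4/3 * (pi - 0) * m \<le> 4/3 * 4 * m"
    using pi_less_4 g[OF t] by (intro mult_right_mono mult_left_mono) auto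
  ultimately show ?thesis using g[OF t] by (simp add: gap_0)
qed

text \<open>If \<open>p1 - p2\<close> outweighs the other term for all radii up to B,
  \<open>src\<close> keeps its sign and so does the gap at pi.\<close>

lemma gap_sign:
  assumes u: "polar_solution u" and B: "\<And>t. t \<in> {0..pi} \<Longrightarrow> u t \<le> B"
    and sg: "\<bar>\<sigma>\<bar> = 1" "0 < \<sigma> * (p1 - p2)" "\<bar>q1 - q2\<bar> * B \<le> \<sigma> * (p1 - p2) / 2"
  shows "0 < \<sigma> * gap u pi"
proof -
  define P where "P = \<sigma> * (p1 - p2)"
  have s: "0 \<le> sin t" "(sin t)^4 \<le> (sin t)^3" "(sin t)^3 \<le> 1" if "t \<in> {0..pi}" for t
    using that sin_ge_zero[of t] by (auto intro: power_decreasing power_le_one)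
  \<comment> \<open>Half of P survives the term with \<open>q1 - q2\<close>, and the weight is at
    least 8/10: together 2/5. The factor sin^3 is lowered to sin^4 to fit
    \<open>forced_linear_pos\<close>.\<close>
  have main: "2/5 * P * (sin t ^ 4) \<le> \<sigma> * src (u t) t \<and> \<sigma> * src (u t) t \<le> 16 * (2/5 * P)" if t: "t \<in> {0..pi}" for t
  proof -
    note b = polar_solution_bounds[OF u t]
    define x where "x = \<sigma> * ((p1 - p2) + (q1 - q2) * (u t * sin t))"
    have "\<bar>\<sigma> * ((q1 - q2) * (u t * sin t))\<bar> \<le> 1 * (\<bar>q1 - q2\<bar> * (B * 1))"
      unfolding abs_mult using b B[OF t] s[OF t] sg by (intro mult_mono) auto
    then have x: "P / 2 \<le> x" "x \<le> 2 * P" using sg(3) unfolding x_def P_def distrib_left by linarith+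
    have P: "0 < P" using sg by (simp add: P_def)
    have sr: "\<sigma> * src (u t) t = (sin t)^3 * (x * wt (u t) t)" by (simp add: src_def x_def)
    have "P / 2 * (8/10) \<le> x * wt (u t) t" by (intro mult_mono x wt_bound b) (use P x in auto)
    then have "(sin t)^4 * (P / 2 * (8/10)) \<le> (sin t)^3 * (x * wt (u t) t)"
      by (rule mult_mono[rotated]) (use P s[OF t] in auto)
    moreover have "x * wt (u t) t \<le> 2 * P * (13/10)"
      by (intro mult_mono x wt_bound b) (use P x wt_bound(1)[OF b(1,2), of t] in auto)
    then have "(sin t)^3 * (x * wt (u t) t) \<le> 1 * (2 * P * (13/10))"
      by (rule mult_mono[rotated]) (use P x wt_bound(1)[OF b(1,2), of t] s[OF t] in auto)
    ultimately show ?thesis using P unfolding sr by (simp add: mult.commute)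
  qed
  have P: "0 < P" using sg by (simp add: P_def)
  show ?thesis
  proof (rule forced_linear_pos[where f = "\<lambda>t. \<sigma> * gap u t" and \<kappa> = "\<lambda>t. kap (u t) (u (- t)) t"
        and g = "\<lambda>t. \<sigma> * src (u t) t" and A = "2/5 * P"])
    fix t assume t: "t \<in> {0..pi}"
    show "((\<lambda>t. \<sigma> * gap u t) has_real_derivative
        kap (u t) (u (- t)) t * (\<sigma> * gap u t) + \<sigma> * src (u t) t) (at t within {0..pi})"
      by (rule DERIV_cong[OF DERIV_cmult[OF gap_deriv[OF u t]]]) (simp add: algebra_simps)
    show "\<bar>kap (u t) (u (- t)) t\<bar> \<le> 1/2000" by (rule kap_bound_solution[OF u t])
    have "2/5 * P * (sin t ^ 4 - 1/100) \<le> 2/5 * P * (sin t ^ 4)" using P by (intro mult_left_mono) auto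
    then show "2/5 * P * (sin t ^ 4 - 1/100) \<le> \<sigma> * src (u t) t" using main[OF t] by linarith
    have "0 \<le> 2/5 * P * (sin t ^ 4)" using P by simp
    then show "\<bar>\<sigma> * src (u t) t\<bar> \<le> 16 * (2/5 * P)" using main[OF t] by linarith
  qed (use P gap_0 in auto)
qed

text \<open>The opposite regime: radii so large, relative to \<open>p1 - p2\<close>, that the sin^4
  term prevails.\<close>

lemma gap_pos:
  assumes u: "polar_solution u" and B: "\<And>t. t \<in> {0..pi} \<Longrightarrow> B \<le> u t" "\<And>t. t \<in> {0..pi} \<Longrightarrow> u t \<le> 2 * B"
    and B0: "0 < B" and q: "0 < q1 - q2" and p: "\<bar>p1 - p2\<bar> \<le> (q1 - q2) * B / 4000"
  shows "0 < gap u pi"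
proof -
  define A where "A = (q1 - q2) * B / 2"
  have A: "0 < A" "\<bar>p1 - p2\<bar> \<le> A / 2000" using B0 q p by (auto simp: A_def)
  have main: "A * (sin t ^ 4 - 1/100) \<le> src (u t) t \<and> \<bar>src (u t) t\<bar> \<le> 16 * A" if t: "t \<in> {0..pi}" for t
  proof -
    note b = polar_solution_bounds[OF u t]
    have s: "0 \<le> sin t" "0 \<le> sin t ^ 4" "sin t ^ 4 \<le> 1" "0 \<le> sin t ^ 3" "sin t ^ 3 \<le> 1"
      using t sin_ge_zero[of t] by (auto intro: power_le_one)
    note w = wt_bound[OF b(1,2), of t]
    have sr: "src (u t) t = (p1 - p2) * (sin t ^ 3 * wt (u t) t) + (q1 - q2) * u t * wt (u t) t * sin t ^ 4"
      by (simp add: src_def algebra_simps eval_nat_numeral)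
    have 1: "\<bar>(p1 - p2) * (sin t ^ 3 * wt (u t) t)\<bar> \<le> A / 2000 * (1 * (13/10))"
      unfolding abs_mult using A s w by (intro mult_mono) auto
    have 2: "A * sin t ^ 4 \<le> (q1 - q2) * u t * wt (u t) t * sin t ^ 4"
    proof -
      have "(q1 - q2) * B * (8/10) \<le> (q1 - q2) * u t * wt (u t) t"
        using q B(1)[OF t] B0 w by (intro mult_mono) auto
      moreover have "A \<le> (q1 - q2) * B * (8/10)" using A(1) unfolding A_def by linarith
      ultimately show ?thesis using s by (intro mult_right_mono) auto
    qed
    have "(q1 - q2) * u t * wt (u t) t * sin t ^ 4 \<le> (q1 - q2) * (2 * B) * (13/10) * 1"
      using q B(2)[OF t] b(1) B0 w s by (intro mult_mono) auto
    also have "\<dots> = A * (26/5)" by (simp add: A_def)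
    finally have 3: "(q1 - q2) * u t * wt (u t) t * sin t ^ 4 \<le> A * (26/5)" .
    have 4: "0 \<le> A * sin t ^ 4" using A s by simp
    have 5: "A * (sin t ^ 4 - 1/100) = A * sin t ^ 4 - A / 100" by (simp add: algebra_simps)
    show ?thesis unfolding sr 5 using 1 2 3 4 A by linarith
  qed
  show ?thesis
    by (rule forced_linear_pos[where f = "gap u" and \<kappa> = "\<lambda>t. kap (u t) (u (- t)) t"
        and g = "\<lambda>t. src (u t) t" and A = A])
       (use gap_deriv[OF u] A gap_0 kap_bound_solution[OF u] main in auto)
qed

lemma closed_gap: "polar_solution u \<Longrightarrow> u (- pi) = u pi \<longleftrightarrow> gap u pi = 0"
  using polar_solutionD(1)[of u pi] polar_solutionD(1)[of u "-pi"] by (auto simp: gap_def)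

text \<open>The difference of two solutions satisfies a linear inequality with constant 1/10000.
  This yields uniqueness, preserved order, and Lipschitz dependence on the initial radius.\<close>

lemma polar_solutions_compare:
  assumes u: "polar_solution u" and v: "polar_solution v" and t: "t \<in> {-pi..pi}"
  shows "\<bar>(v t - u t) - (v 0 - u 0)\<bar> \<le> \<bar>v 0 - u 0\<bar> / 3"
proof -
  have "\<bar>(v t - u t) - (v 0 - u 0)\<bar> \<le> \<bar>v 0 - u 0\<bar> / 3 + 4/3 * (pi - - pi) * 0"
  proof (rule small_gronwall[where f = "\<lambda>t. v t - u t" and k = "1/10000"])
    fix t assume t: "t \<in> {-pi..pi}"
    show "((\<lambda>t. v t - u t) has_real_derivative F (v t) t - F (u t) t) (at t within {-pi..pi})"
      by (intro DERIV_diff polar_solutionD(3) u v t)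
    show "\<bar>F (v t) t - F (u t) t\<bar> \<le> 1/10000 * \<bar>v t - u t\<bar> + 0"
      using F_lipschitz[of "v t" "u t" t] polar_solutionD(1,2)[OF u t] polar_solutionD(1,2)[OF v t] by simp
  qed (use t pi_less_4 in auto)
  then show ?thesis by simp
qed

lemma polar_solution_unique:
  assumes "polar_solution u" "polar_solution v" "u 0 = v 0"
  shows "polar_curve u = polar_curve v"
  unfolding polar_curve_def
  by (rule image_cong) (use polar_solutions_compare[OF assms(1,2)] assms(3) in auto)

text \<open>If \<open>p1 - p2\<close> dominates, already the gap of a is nonzero. Otherwise
  \<bar>\<open>p1 - p2\<close>\<bar> is at most 2 * Q * \<open>rad\<close>, and in the equation for
  the difference of the gaps both main term and errors carry the factor Q * hh, so neither small Q
  nor close orbits spoil the comparison.\<close>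

lemma closed_polar_solutions_not_less:
  assumes a: "polar_solution a" "a (- pi) = a pi" and b: "polar_solution b" "b (- pi) = b pi"
    and ne: "\<not> (p1 = p2 \<and> q1 = q2)" and less: "a 0 < b 0"
  shows False
proof (cases "\<bar>q1 - q2\<bar> * rad \<le> \<bar>p1 - p2\<bar> / 2")
  case True
  have "p1 - p2 \<noteq> 0" using True ne by auto
  note sg = sgn_real_facts[OF this]
  then have "0 < sgn (p1 - p2) * gap a pi"
    by (intro gap_sign[OF a(1), of rad])
       (use True \<open>p1 - p2 \<noteq> 0\<close> sg polar_solution_bounds[OF a(1)] in auto)
  then show False using closed_gap[OF a(1)] a(2) by simp
next
  case False
  define Q where "Q = \<bar>q1 - q2\<bar>"
  define \<sigma> where "\<sigma> = sgn (q1 - q2)"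
  define hh where "hh = b 0 - a 0"
  have pQ: "\<bar>p1 - p2\<bar> \<le> 2 * (Q * rad)" using False by (simp add: Q_def)
  have Q: "0 < Q" using False unfolding Q_def by (auto simp: not_le)
  have \<sigma>: "\<sigma> * (q1 - q2) = Q" "\<bar>\<sigma>\<bar> = 1" using Q sgn_real_facts[of "q1 - q2"] by (auto simp: \<sigma>_def Q_def)
  have hh: "0 < hh" using less by (simp add: hh_def)
  \<comment> \<open>A lower bound for the coefficient of sin^4: 2/3 * hh from the spacing and 8/10
    from the weight give more than hh / 2.\<close>
  define A where "A = Q * hh / 2"
  have A: "0 < A" using Q hh by (simp add: A_def)
  have cmp: "2/3 * hh \<le> b t - a t" "b t - a t \<le> 4/3 * hh" if "t \<in> {-pi..pi}" for t
    using polar_solutions_compare[OF a(1) b(1) that, folded hh_def] hh by (simp_all only: abs_of_pos abs_le_iff; linarith)+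
  define lin where "lin r t = (p1 - p2) + (q1 - q2) * (r * sin t)" for r t
  have lin: "\<bar>lin r t\<bar> \<le> 3 * (Q * rad)" if "0 \<le> r" "r \<le> rad" for r t
  proof -
    have "\<bar>(q1 - q2) * (r * sin t)\<bar> \<le> Q * (rad * 1)"
      unfolding abs_mult Q_def using that by (intro mult_mono) auto
    with pQ show ?thesis unfolding lin_def by linarith
  qed
  have src: "src r t = (sin t)^3 * (lin r t * wt r t)" for r t by (simp add: src_def lin_def)
  \<comment> \<open>In this regime both terms of \<open>lin\<close> are of order Q *
    \<open>rad\<close>, hence so is the gap.\<close>
  have gapa: "\<bar>gap a t\<bar> \<le> 6 * (1 * (3 * (Q * rad) * 2))" if "t \<in> {0..pi}" for t
  proof (rule gap_bound[OF a(1) _ that])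
    fix t assume t: "t \<in> {0..pi}"
    note b = polar_solution_bounds[OF a(1) t]
    show "\<bar>src (a t) t\<bar> \<le> 1 * (3 * (Q * rad) * 2)"
      unfolding src abs_mult using wt_bound[OF b(1,2), of t] Q
      by (intro mult_mono sin_pow_bound lin b) auto
  qed
  \<comment> \<open>Taking \<open>kap\<close> along b as the coefficient of the difference moves the
    change of \<open>kap\<close>, times the gap of a, into the forcing.\<close>
  define g where "g t = \<sigma> * ((kap (b t) (b (- t)) t - kap (a t) (a (- t)) t) * gap a t + (src (b t) t - src (a t) t))" for t
  have main: "A * (sin t ^ 4 - 1/100) \<le> g t \<and> \<bar>g t\<bar> \<le> 16 * A" if t: "t \<in> {0..pi}" for t
  proof -
    note ba = polar_solution_bounds[OF a(1) t] and bb = polar_solution_bounds[OF b(1) t]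
    have e: "2/3 * hh \<le> b t - a t" "b t - a t \<le> 4/3 * hh" "\<bar>b t - a t\<bar> \<le> 4/3 * hh" "\<bar>b (- t) - a (- t)\<bar> \<le> 4/3 * hh"
      using cmp[of t] cmp[of "- t"] t hh by auto
    have s: "0 \<le> sin t ^ 4" "sin t ^ 4 \<le> 1" by (auto intro: power_le_one simp: power_le_one_iff)
       (metis abs_le_D1 power_even_abs_numeral sin_pow_bound even_numeral)
    have "\<bar>kap (b t) (b (- t)) t - kap (a t) (a (- t)) t\<bar> \<le> 100 * rad * (\<bar>b t - a t\<bar> + \<bar>b (- t) - a (- t)\<bar>)"
      by (rule kap_lipschitz) (use ba bb in auto)
    also have "\<dots> \<le> 100 * rad * (4/3 * hh + 4/3 * hh)" by (intro mult_left_mono add_mono e) auto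
    finally have "\<bar>(kap (b t) (b (- t)) t - kap (a t) (a (- t)) t) * gap a t\<bar>
        \<le> (100 * rad * (4/3 * hh + 4/3 * hh)) * (6 * (1 * (3 * (Q * rad) * 2)))"
      unfolding abs_mult by (intro mult_mono gapa t) (use hh in auto)
    also have "\<dots> \<le> A / 1000" using Q hh by (simp add: A_def)
    finally have 1: "\<bar>\<sigma> * ((kap (b t) (b (- t)) t - kap (a t) (a (- t)) t) * gap a t)\<bar> \<le> A / 1000"
      using \<sigma> by (simp add: abs_mult)
    have "\<bar>lin (b t) t * (wt (b t) t - wt (a t) t)\<bar> \<le> 3 * (Q * rad) * (50 * (4/3 * hh))"
      unfolding abs_mult
      by (intro mult_mono lin order.trans[OF wt_lipschitz[OF bb(1,2) ba(1,2)]] mult_left_mono e bb) (use Q in auto)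
    then have "\<bar>\<sigma> * ((sin t)^3 * (lin (b t) t * (wt (b t) t - wt (a t) t)))\<bar> \<le> 1 * (1 * (3 * (Q * rad) * (50 * (4/3 * hh))))"
      unfolding abs_mult[of \<sigma>] abs_mult[of "_ ^ _"] by (intro mult_mono sin_pow_bound) (use \<sigma> Q hh in auto)
    also have "\<dots> \<le> A / 1000" using Q hh by (simp add: A_def)
    finally have 2: "\<bar>\<sigma> * ((sin t)^3 * (lin (b t) t * (wt (b t) t - wt (a t) t)))\<bar> \<le> A / 1000" .
    define X where "X = Q * (b t - a t) * wt (a t) t"
    note w = wt_bound[OF ba(1,2), of t]
    have X: "A \<le> X" "X \<le> 4 * A"
    proof -
      have "Q * (2/3 * hh) * (8/10) \<le> X" unfolding X_def using Q hh e w by (intro mult_mono) auto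
      moreover have "A \<le> Q * (2/3 * hh) * (8/10)" using Q hh by (simp add: A_def)
      ultimately show "A \<le> X" by linarith
      have "X \<le> Q * (4/3 * hh) * (13/10)" unfolding X_def using Q hh e w by (intro mult_mono) auto
      moreover have "Q * (4/3 * hh) * (13/10) \<le> 4 * A" using Q hh by (simp add: A_def)
      ultimately show "X \<le> 4 * A" by linarith
    qed
    \<comment> \<open>The change of the weight is multiplied by the small \<open>lin\<close>; the
      change of \<open>lin\<close> supplies the sin^4 term.\<close>
    have srcd: "src (b t) t - src (a t) t = (sin t)^3 * (lin (b t) t * (wt (b t) t - wt (a t) t))
        + (sin t)^4 * ((q1 - q2) * (b t - a t) * wt (a t) t)"
      unfolding src lin_def by algebra
    have "g t = \<sigma> * ((kap (b t) (b (- t)) t - kap (a t) (a (- t)) t) * gap a t)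
        + \<sigma> * ((sin t)^3 * (lin (b t) t * (wt (b t) t - wt (a t) t)))
        + (sin t)^4 * (\<sigma> * (q1 - q2) * (b t - a t) * wt (a t) t)"
      unfolding g_def srcd by algebra
    then have g: "g t = \<sigma> * ((kap (b t) (b (- t)) t - kap (a t) (a (- t)) t) * gap a t)
        + \<sigma> * ((sin t)^3 * (lin (b t) t * (wt (b t) t - wt (a t) t))) + (sin t)^4 * X"
      unfolding \<sigma>(1) X_def .
    have "(sin t)^4 * A \<le> (sin t)^4 * X" "(sin t)^4 * X \<le> 1 * (4 * A)"
      using mult_left_mono[OF X(1) s(1)] mult_mono[OF s(2) X(2)] X A by simp_all
    moreover have "0 \<le> (sin t)^4 * A" using s A by simp
    moreover have "A * (sin t ^ 4 - 1/100) = (sin t)^4 * A - A / 100" by (simp add: algebra_simps)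
    ultimately show ?thesis unfolding g using 1 2 A by linarith
  qed
  have "0 < \<sigma> * (gap b pi - gap a pi)"
  proof (rule forced_linear_pos[where f = "\<lambda>t. \<sigma> * (gap b t - gap a t)" and \<kappa> = "\<lambda>t. kap (b t) (b (- t)) t"
        and g = g and A = A])
    fix t assume t: "t \<in> {0..pi}"
    show "((\<lambda>t. \<sigma> * (gap b t - gap a t)) has_real_derivative
        kap (b t) (b (- t)) t * (\<sigma> * (gap b t - gap a t)) + g t) (at t within {0..pi})"
      by (rule DERIV_cong[OF DERIV_cmult[OF DERIV_diff[OF gap_deriv[OF b(1) t] gap_deriv[OF a(1) t]]]])
         (simp add: g_def algebra_simps)
  qed (use A gap_0 kap_bound_solution[OF b(1)] main in auto)
  then show False using a b closed_gap by auto
qed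

lemma closed_polar_solutions_eq:
  assumes "polar_solution a" "a (- pi) = a pi" "polar_solution b" "b (- pi) = b pi"
    and "\<not> (p1 = p2 \<and> q1 = q2)"
  shows "polar_curve a = polar_curve b"
proof -
  have "a 0 = b 0"
    using closed_polar_solutions_not_less[OF assms] closed_polar_solutions_not_less[OF assms(3,4,1,2,5)]
      linorder_less_linear[of "a 0" "b 0"] by blast
  then show ?thesis using polar_solution_unique assms by blast
qed

section \<open>From closed solutions to limit cycles and centers\<close>

lemma polar_curve_norm:
  assumes "polar_solution u" "z \<in> polar_curve u"
  obtains t where "t \<in> {-pi..pi}" "norm z = u t"
proof -
  obtain t where t: "t \<in> {-pi..pi}" "z = (u t * cos t, u t * sin t)"
    using assms(2) by (auto simp: polar_curve_def)
  have "(u t * cos t)^2 + (u t * sin t)^2 = (u t)^2 * ((sin t)^2 + (cos t)^2)"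
    by (simp only: power_mult_distrib) algebra
  then have "norm z = u t" using t polar_solutionD(1)[OF assms(1) t(1)] by (simp add: norm_Pair)
  with t(1) that show ?thesis by blast
qed

lemma polar_curve_subset:
  assumes "polar_solution u" shows "polar_curve u \<subseteq> ball 0 rad - {0}"
proof
  fix z assume "z \<in> polar_curve u"
  then obtain t where t: "t \<in> {-pi..pi}" "norm z = u t" using polar_curve_norm[OF assms] by blast
  then have "0 < norm z" "norm z < rad" using polar_solutionD(1,2)[OF assms t(1)] by auto
  then show "z \<in> ball 0 rad - {0}" by auto
qed

lemma origin_inside:
  assumes "polar_solution u" "u (- pi) = u pi"
  shows "(0, 0) \<in> inside (polar_curve u)"
  by (rule origin_inside_polar_curve[OF DERIV_continuous_on[OF polar_solutionD(3)[OF assms(1)]]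
        polar_solutionD(1)[OF assms(1)] assms(2)])

text \<open>The whole punctured ball isolates the orbit, since every periodic orbit in it is a
  closed polar graph and these all coincide.\<close>

lemma limit_cycle_polar_curve:
  assumes "polar_solution u" "u (- pi) = u pi" "\<not> (p1 = p2 \<and> q1 = q2)"
  shows "limit_cycle up lo (polar_curve u)"
  unfolding limit_cycle_def
proof (intro conjI exI allI impI)
  show "periodic_orbit up lo (polar_curve u)" by (rule periodic_orbit_polar_curve[OF assms(1,2)])
  show "open (ball 0 rad - {0 :: real \<times> real})" by (intro open_Diff) auto
  show "polar_curve u \<subseteq> ball 0 rad - {0}" by (rule polar_curve_subset[OF assms(1)])
  fix \<Gamma>' assume \<Gamma>': "periodic_orbit up lo \<Gamma>' \<and> \<Gamma>' \<subseteq> ball 0 rad - {0}"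
  then obtain v where "polar_solution v" "v (- pi) = v pi" "\<Gamma>' = polar_curve v"
    using periodic_orbit_is_polar_curve by blast
  then show "\<Gamma>' = polar_curve u" using closed_polar_solutions_eq assms by metis
qed

text \<open>The system is reversible under y \<mapsto> -y. Here this appears as \<open>src\<close> =
  0, so the gap solves a homogeneous linear equation from 0.\<close>

lemma symmetric_closed:
  assumes sym: "p1 = p2" "q1 = q2" and u: "polar_solution u"
  shows "u (- pi) = u pi"
proof -
  have src0: "src r t = 0" for r t unfolding src_def using sym by simp
  have "\<bar>gap u pi\<bar> \<le> 6 * 0" 
  proof (rule gap_bound[OF u])
    show "\<bar>src (u t) t\<bar> \<le> 0" for t unfolding src0 by simp
  qed simp
  then show ?thesis using closed_gap[OF u] by simp
qed

lemma symmetric_not_limit_cycle: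
  assumes sym: "p1 = p2" "q1 = q2" and u: "polar_solution u" and small: "u 0 < rad / 4"
  shows "\<not> limit_cycle up lo (polar_curve u)"
proof
  assume "limit_cycle up lo (polar_curve u)"
  then have "\<exists>V. open V \<and> polar_curve u \<subseteq> V \<and>
      (\<forall>\<Gamma>'. periodic_orbit up lo \<Gamma>' \<and> \<Gamma>' \<subseteq> V \<longrightarrow> \<Gamma>' = polar_curve u)"
    unfolding limit_cycle_def by (rule conjunct2)
  then obtain V where V: "open V" "polar_curve u \<subseteq> V"
    "\<forall>\<Gamma>'. periodic_orbit up lo \<Gamma>' \<and> \<Gamma>' \<subseteq> V \<longrightarrow> \<Gamma>' = polar_curve u"
    by (elim exE conjE)
  have "continuous_on {-pi..pi} u"
    using polar_solutionD(3)[OF u] by (rule DERIV_continuous_on)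
  then have "compact (polar_curve u)"
    unfolding polar_curve_def by (intro compact_continuous_image continuous_intros compact_Icc)
  then obtain e where e: "0 < e" "(\<Union>x\<in>polar_curve u. ball x e) \<subseteq> V"
    using compact_subset_open_imp_ball_epsilon_subset V(1,2) by metis
  \<comment> \<open>The bound \<open>rad / 4\<close> keeps the new initial radius within the range
    of \<open>polar_solution_exists\<close>; \<open>e / 2\<close> keeps the new curve in the tube,
    as distances grow to at most 4/3 * d.\<close>
  define d where "d = min (rad / 4) (e / 2)"
  have d: "0 < d" "d \<le> rad / 4" "4/3 * d < e" using e by (auto simp: d_def)
  have u0: "0 < u 0" using polar_solutionD(1)[OF u, of 0] by simp
  obtain v where v: "polar_solution v" "v 0 = u 0 + d"
    using polar_solution_exists[of 0 "u 0 + d"] u0 small d by auto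
  have "polar_curve v \<subseteq> V"
  proof
    fix z assume "z \<in> polar_curve v"
    then obtain t where t: "t \<in> {-pi..pi}" "z = (v t * cos t, v t * sin t)" by (auto simp: polar_curve_def)
    define x where "x = (u t * cos t, u t * sin t)"
    have "x \<in> polar_curve u" using t(1) by (auto simp: polar_curve_def x_def)
    have "\<bar>v t - u t\<bar> \<le> 4/3 * d"
    proof -
      have "v 0 - u 0 = d" using v(2) by simp
      from polar_solutions_compare[OF u v(1) t(1), unfolded this] show ?thesis using d(1) by linarith
    qed
    moreover have "dist x z = \<bar>v t - u t\<bar>"
    proof -
      have "(u t * cos t - v t * cos t)^2 + (u t * sin t - v t * sin t)^2
          = (v t - u t)^2 * ((sin t)^2 + (cos t)^2)" by algebra
      then show ?thesis by (simp add: dist_Pair_Pair x_def t(2) dist_real_def)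
    qed
    ultimately have "z \<in> ball x e" using d(3) by simp
    with \<open>x \<in> polar_curve u\<close> e(2) show "z \<in> V" by blast
  qed
  with V(3) periodic_orbit_polar_curve[OF v(1) symmetric_closed[OF sym v(1)]]
  have "polar_curve v = polar_curve u" by blast
  from polar_curve_axis[OF this polar_solutionD(1)[OF v(1)] polar_solutionD(1)[OF u]]
  show False using v(2) d(1) by simp
qed

text \<open>Surrounding the origin implies not passing through it, so the classification applies.
  The curve contains (\<open>u 0\<close>, 0), so the ball gives \<open>u 0 < rad / 4\<close> and
  isolation rules out equal coefficient pairs.\<close>

lemma at_most_one_limit_cycle:
  "\<exists>\<^sub>\<le>\<^sub>1\<Gamma>. limit_cycle up lo \<Gamma> \<and> (0, 0) \<in> inside \<Gamma> \<and> \<Gamma> \<subseteq> ball 0 (rad / 4)"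
proof (rule Uniq_I)
  have rep: "\<exists>u. polar_solution u \<and> u (- pi) = u pi \<and> \<Gamma> = polar_curve u \<and> \<not> (p1 = p2 \<and> q1 = q2)"
    if \<Gamma>: "limit_cycle up lo \<Gamma> \<and> (0, 0) \<in> inside \<Gamma> \<and> \<Gamma> \<subseteq> ball 0 (rad / 4)" for \<Gamma>
  proof -
    have "(0, 0) \<notin> \<Gamma>" using \<Gamma> by (auto simp: inside_def)
    then have "0 \<notin> \<Gamma>" by (simp add: zero_prod_def)
    moreover have "ball 0 (rad / 4) \<subseteq> ball (0 :: real \<times> real) rad" by (rule subset_ball) simp
    ultimately have "\<Gamma> \<subseteq> ball 0 rad - {0}" using \<Gamma> by blast
    then obtain u where u: "polar_solution u" "u (- pi) = u pi" "\<Gamma> = polar_curve u"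
      using \<Gamma> periodic_orbit_is_polar_curve unfolding limit_cycle_def by blast
    have "(u 0 * cos 0, u 0 * sin 0) \<in> \<Gamma>" unfolding u(3) polar_curve_def by (rule image_eqI[OF refl]) simp
    then have "norm (u 0, 0 :: real) < rad / 4" using \<Gamma> by auto
    then have "u 0 < rad / 4" by (simp add: norm_Pair)
    then show ?thesis using u symmetric_not_limit_cycle \<Gamma> by blast
  qed
  fix \<Gamma> \<Gamma>'
  assume "limit_cycle up lo \<Gamma> \<and> (0, 0) \<in> inside \<Gamma> \<and> \<Gamma> \<subseteq> ball 0 (rad / 4)"
    and "limit_cycle up lo \<Gamma>' \<and> (0, 0) \<in> inside \<Gamma>' \<and> \<Gamma>' \<subseteq> ball 0 (rad / 4)"
  then show "\<Gamma> = \<Gamma>'" using rep closed_polar_solutions_eq by metis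
qed

lemma symmetric_is_center:
  assumes sym: "p1 = p2" "q1 = q2"
  shows "is_center up lo (0, 0)"
  unfolding is_center_def
proof (rule exI[of _ "ball 0 (rad / 2)"], intro conjI ballI)
  show "open (ball 0 (rad / 2) :: (real \<times> real) set)" "(0, 0) \<in> (ball 0 (rad / 2) :: (real \<times> real) set)"
    by (auto simp: zero_prod_def[symmetric])
next
  fix z :: "real \<times> real" assume z: "z \<in> ball 0 (rad / 2) - {(0, 0)}"
  obtain t where t: "t \<in> {-pi..pi}" "z = (norm z * cos t, norm z * sin t)" by (rule polar_representation)
  have "0 < norm z" "norm z \<le> rad / 2" using z by (simp_all add: zero_prod_def[symmetric] less_imp_le)
  then obtain u where u: "polar_solution u" "u t = norm z"
    using polar_solution_exists[OF t(1)] by metis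
  note cl = symmetric_closed[OF sym u(1)]
  have "z \<in> polar_curve u" unfolding polar_curve_def
    by (rule image_eqI[OF _ t(1)]) (simp only: u(2) t(2)[symmetric])
  then show "\<exists>\<Gamma>. periodic_orbit up lo \<Gamma> \<and> z \<in> \<Gamma> \<and> (0, 0) \<in> inside \<Gamma>"
    using periodic_orbit_polar_curve[OF u(1) cl] origin_inside[OF u(1) cl] by blast
qed

text \<open>A shooting argument in the initial radius: opposite signs of the gap at
  \<open>r1\<close> and \<open>r2\<close> force a closed solution in between.\<close>

lemma closed_polar_solution_exists:
  assumes r: "0 < r1" "r1 \<le> r2" "r2 \<le> rad / 2"
    and lo: "\<And>u. polar_solution u \<Longrightarrow> u 0 = r1 \<Longrightarrow> (\<And>t. t \<in> {-pi..pi} \<Longrightarrow> \<bar>u t - r1\<bar> \<le> r1 / 3) \<Longrightarrow> gap u pi < 0"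
    and hi: "\<And>u. polar_solution u \<Longrightarrow> u 0 = r2 \<Longrightarrow> (\<And>t. t \<in> {-pi..pi} \<Longrightarrow> \<bar>u t - r2\<bar> \<le> r2 / 3) \<Longrightarrow> gap u pi > 0"
  obtains u where "polar_solution u" "u (- pi) = u pi" "\<And>t. t \<in> {-pi..pi} \<Longrightarrow> u t \<le> 4/3 * r2"
proof -
  have "\<exists>u. polar_solution u \<and> u 0 = r \<and> (\<forall>t\<in>{-pi..pi}. \<bar>u t - r\<bar> \<le> r / 3)" if "r \<in> {r1..r2}" for r
  proof -
    have "0 \<in> {-pi..pi}" "0 < r" "r \<le> rad / 2" using that r by auto
    then obtain u where "polar_solution u" "u 0 = r" "\<And>t. t \<in> {-pi..pi} \<Longrightarrow> \<bar>u t - r\<bar> \<le> r / 3"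
      using polar_solution_exists[of 0 r] by metis
    then show ?thesis by (intro exI[of _ u]) simp
  qed
  then obtain U where U: "\<And>r. r \<in> {r1..r2} \<Longrightarrow> polar_solution (U r)" "\<And>r. r \<in> {r1..r2} \<Longrightarrow> U r 0 = r"
    "\<And>r t. r \<in> {r1..r2} \<Longrightarrow> t \<in> {-pi..pi} \<Longrightarrow> \<bar>U r t - r\<bar> \<le> r / 3"
    by metis
  \<comment> \<open>\<open>D\<close> has the sign of the gap but contains no reciprocals, so its
    Lipschitz bound follows directly from \<open>polar_solutions_compare\<close>.\<close>
  define D where "D r = U r pi - U r (- pi)" for r
  have gapD: "gap (U r) pi = D r / (U r pi * U r (- pi))" "0 < U r pi * U r (- pi)" if "r \<in> {r1..r2}" for r
    using polar_solutionD(1)[OF U(1)[OF that], of pi] polar_solutionD(1)[OF U(1)[OF that], of "- pi"]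
    by (auto simp: gap_def D_def field_simps)
  have lipD: "\<bar>D r - D r'\<bar> \<le> 3 * \<bar>r - r'\<bar>" if "r \<in> {r1..r2}" "r' \<in> {r1..r2}" for r r'
  proof -
    have "\<bar>(U r t - U r' t) - (r - r')\<bar> \<le> \<bar>r - r'\<bar> / 3" if "t \<in> {pi, - pi}" for t
      using polar_solutions_compare[OF U(1) U(1), of r' r t] U(2) \<open>r \<in> _\<close> \<open>r' \<in> _\<close> that by auto
    from this[of pi] this[of "- pi"]
    have "\<bar>(U r pi - U r' pi) - (r - r')\<bar> \<le> \<bar>r - r'\<bar> / 3"
      "\<bar>(U r (- pi) - U r' (- pi)) - (r - r')\<bar> \<le> \<bar>r - r'\<bar> / 3" by simp_all
    moreover have "\<bar>x - y\<bar> \<le> 3 * \<bar>d\<bar>" if "\<bar>x - d\<bar> \<le> \<bar>d\<bar> / 3" "\<bar>y - d\<bar> \<le> \<bar>d\<bar> / 3" for x y d :: real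
      using that by linarith
    ultimately have "\<bar>(U r pi - U r' pi) - (U r (- pi) - U r' (- pi))\<bar> \<le> 3 * \<bar>r - r'\<bar>" by blast
    then show ?thesis by (simp add: D_def algebra_simps)
  qed
  have "continuous_on {r1..r2} D"
    unfolding continuous_on_iff
  proof (intro ballI allI impI)
    fix x e :: real assume "x \<in> {r1..r2}" "0 < e"
    then show "\<exists>d>0. \<forall>x'\<in>{r1..r2}. dist x' x < d \<longrightarrow> dist (D x') (D x) < e"
      using lipD by (intro exI[of _ "e / 3"]) (fastforce simp: dist_real_def)
  qed
  moreover have "D r1 \<le> 0" "0 \<le> D r2"
  proof -
    have i: "r1 \<in> {r1..r2}" "r2 \<in> {r1..r2}" using r by auto
    have "gap (U r1) pi < 0" "gap (U r2) pi > 0" using lo hi U i by blast+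
    then show "D r1 \<le> 0" "0 \<le> D r2"
      using gapD[OF i(1)] gapD[OF i(2)] by (auto simp: divide_less_0_iff zero_less_divide_iff)
  qed
  ultimately obtain r where r': "r1 \<le> r" "r \<le> r2" "D r = 0"
    using IVT'[of D r1 0 r2] r by auto
  then have i: "r \<in> {r1..r2}" by simp
  show ?thesis
  proof (rule that[OF U(1)[OF i]])
    show "U r (- pi) = U r pi" using r'(3) by (simp add: D_def)
    show "U r t \<le> 4/3 * r2" if "t \<in> {-pi..pi}" for t
      using U(3)[OF i that] r' by linarith
  qed
qed

end

section \<open>The given switching system and its parameters\<close>

lemma field_params:
  fixes \<epsilon> :: real
  assumes b: "b = (b12, b13, b22, b23)" and small: "\<bar>\<epsilon>\<bar> * norm b \<le> 1/2"
  shows "lienard (\<epsilon> * b12) (\<epsilon> * b13 - 1/3) (\<epsilon> * b22) (- \<epsilon> * b23 - 1/3)"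
    and "upper_field \<epsilon> b = lienard.up (\<epsilon> * b12) (\<epsilon> * b13 - 1/3)"
    and "lower_field \<epsilon> b = lienard.lo (\<epsilon> * b22) (- \<epsilon> * b23 - 1/3)"
proof -
  have "\<bar>b12\<bar> \<le> norm b" "\<bar>b13\<bar> \<le> norm b" "\<bar>b22\<bar> \<le> norm b" "\<bar>b23\<bar> \<le> norm b"
    using norm_fst_le[of b12 "(b13, b22, b23)"] norm_snd_le[of "(b13, b22, b23)" b12]
      norm_fst_le[of b13 "(b22, b23)"] norm_snd_le[of "(b22, b23)" b13]
      norm_fst_le[of b22 b23] norm_snd_le[of b23 b22] unfolding b real_norm_def by linarith+
  then have "\<bar>\<epsilon> * x\<bar> \<le> 1/2" if "x \<in> {b12, b13, b22, b23}" for x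
  proof -
    assume "\<bar>b12\<bar> \<le> norm b" "\<bar>b13\<bar> \<le> norm b" "\<bar>b22\<bar> \<le> norm b" "\<bar>b23\<bar> \<le> norm b"
    with that have "\<bar>x\<bar> \<le> norm b" by auto
    then have "\<bar>\<epsilon>\<bar> * \<bar>x\<bar> \<le> \<bar>\<epsilon>\<bar> * norm b" by (intro mult_left_mono) auto
    with small show ?thesis by (simp add: abs_mult)
  qed
  then have y: "\<bar>\<epsilon> * b12\<bar> \<le> 1/2" "\<bar>\<epsilon> * b13\<bar> \<le> 1/2" "\<bar>\<epsilon> * b22\<bar> \<le> 1/2" "\<bar>\<epsilon> * b23\<bar> \<le> 1/2"
    by simp_all
  \<comment> \<open>The perturbations are at most 1/2, so the cubic coefficients are at most 1/3 +
    1/2 < 1. The lower cubic coefficient enters with reversed sign, hence \<open>q1\<close> =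
    \<open>q2\<close> at \<epsilon> = 0.\<close>
  show l: "lienard (\<epsilon> * b12) (\<epsilon> * b13 - 1/3) (\<epsilon> * b22) (- \<epsilon> * b23 - 1/3)"
    using y by unfold_locales linarith+
  show "upper_field \<epsilon> b = lienard.up (\<epsilon> * b12) (\<epsilon> * b13 - 1/3)"
    unfolding lienard.up_def[OF l] by (auto simp: upper_field_def b fun_eq_iff algebra_simps)
  show "lower_field \<epsilon> b = lienard.lo (\<epsilon> * b22) (- \<epsilon> * b23 - 1/3)"
    unfolding lienard.lo_def[OF l] by (auto simp: lower_field_def b fun_eq_iff algebra_simps)
qed

lemma is_center_unperturbed: "is_center (upper_field 0 b) (lower_field 0 b) (0, 0)"
proof -
  obtain b12 b13 b22 b23 where b: "b = (b12, b13, b22, b23)" by (cases b)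
  have small: "\<bar>0\<bar> * norm b \<le> (1/2 :: real)" by simp
  note f = field_params[OF b small]
  show ?thesis
    unfolding f(2,3) by (rule lienard.symmetric_is_center[OF f(1)]) simp_all
qed

lemma at_most_one_origin_limit_cycle:
  assumes "\<bar>\<epsilon>\<bar> * norm b \<le> 1/2"
  shows "\<exists>\<^sub>\<le>\<^sub>1\<Gamma>. origin_limit_cycle \<epsilon> b (ball 0 (rad / 4)) \<Gamma>"
proof -
  obtain b12 b13 b22 b23 where b: "b = (b12, b13, b22, b23)" by (cases b)
  note f = field_params[OF b assms]
  show ?thesis
    unfolding origin_limit_cycle_def f(2,3) by (rule lienard.at_most_one_limit_cycle[OF f(1)])
qed

text \<open>Since \<epsilon> is a common factor of both coefficient differences, \<beta> alone sets
  the size of the cycle, and \<epsilon> can be made small independently.\<close>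

lemma origin_limit_cycle_exists:
  fixes \<beta> \<epsilon> :: real
  assumes \<beta>: "0 < \<beta>" "\<beta> \<le> rad / 12000" and \<epsilon>: "0 < \<epsilon>" "\<epsilon> \<le> 1/4"
    and U: "ball 0 (10000 * \<beta>) \<subseteq> U"
  obtains \<Gamma> where "origin_limit_cycle \<epsilon> (- \<beta>, 1, 0, 0) U \<Gamma>"
proof -
  define b where "b = (- \<beta>, 1 :: real, 0 :: real, 0 :: real)"
  have "norm b \<le> \<beta> + 1"
  proof -
    have "norm b \<le> norm (- \<beta>) + norm (1 :: real, 0 :: real, 0 :: real)" unfolding b_def by (rule norm_Pair_le)
    then show ?thesis using \<beta>(1) by (simp add: norm_Pair)
  qed
  then have "norm b \<le> 2" using \<beta> by linarith
  then have "\<bar>\<epsilon>\<bar> * norm b \<le> 1/4 * 2" using \<epsilon> by (intro mult_mono) auto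
  then have small: "\<bar>\<epsilon>\<bar> * norm b \<le> 1/2" by simp
  note f = field_params[OF b_def small]
  interpret lienard "\<epsilon> * - \<beta>" "\<epsilon> * 1 - 1/3" "\<epsilon> * 0" "- \<epsilon> * 0 - 1/3" by (rule f(1))
  have \<epsilon>\<beta>: "0 < \<epsilon> * \<beta>" using \<beta> \<epsilon> by simp
  obtain u where u: "polar_solution u" "u (- pi) = u pi" "\<And>t. t \<in> {-pi..pi} \<Longrightarrow> u t \<le> 4/3 * (6000 * \<beta>)"
  \<comment> \<open>From 3/8 * \<beta> the radius stays below \<beta> / 2, exactly what
    \<open>gap_sign\<close> tolerates. From 6000 * \<beta> it stays between 4000 * \<beta> and 8000
    * \<beta>, where \<open>gap_pos\<close> with B = 4000 * \<beta> holds with equality in its last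
    hypothesis.\<close>
  proof (rule closed_polar_solution_exists[of "3/8 * \<beta>" "6000 * \<beta>"])
    show "0 < 3/8 * \<beta>" "3/8 * \<beta> \<le> 6000 * \<beta>" "6000 * \<beta> \<le> rad / 2" using \<beta> by linarith+
    fix u assume u: "polar_solution u" "\<And>t. t \<in> {-pi..pi} \<Longrightarrow> \<bar>u t - 3/8 * \<beta>\<bar> \<le> 3/8 * \<beta> / 3"
    have "u t \<le> \<beta> / 2" if "t \<in> {0..pi}" for t
    proof -
      have "t \<in> {-pi..pi}" using that by auto
      from u(2)[OF this] show ?thesis by linarith
    qed
    then have "0 < (-1) * gap u pi"
      by (rule gap_sign[OF u(1)]) (use \<epsilon>\<beta> \<epsilon> in auto)
    then show "gap u pi < 0" by simp
  next
    fix u assume u: "polar_solution u" "\<And>t. t \<in> {-pi..pi} \<Longrightarrow> \<bar>u t - 6000 * \<beta>\<bar> \<le> 6000 * \<beta> / 3"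
    have *: "4000 * \<beta> \<le> u t" "u t \<le> 2 * (4000 * \<beta>)" if "t \<in> {0..pi}" for t
      using u(2)[of t] that by (auto simp: abs_le_iff)
    show "0 < gap u pi"
      by (rule gap_pos[OF u(1) *]) (use \<epsilon>\<beta> \<epsilon> \<beta> in \<open>auto simp: abs_mult\<close>)
  qed blast
  have "polar_curve u \<subseteq> U"
  proof
    fix z assume "z \<in> polar_curve u"
    then obtain t where "t \<in> {-pi..pi}" "norm z = u t" using polar_curve_norm[OF u(1)] by blast
    then have "norm z < 10000 * \<beta>" using u(3)[of t] \<beta>(1) by simp
    then show "z \<in> U" using U by auto
  qed
  moreover have "limit_cycle up lo (polar_curve u)"
    by (rule limit_cycle_polar_curve[OF u(1,2)]) (use \<epsilon>\<beta> \<epsilon> in auto)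
  ultimately have "origin_limit_cycle \<epsilon> b U (polar_curve u)"
    unfolding origin_limit_cycle_def f(2,3) using origin_inside[OF u(1,2)] by simp
  then show ?thesis using that unfolding b_def by blast
qed

theorem theorem19:
  shows "(\<forall>b. is_center (upper_field 0 b) (lower_field 0 b) (0, 0)) \<and>
    (\<forall>bs :: params. \<exists>U \<epsilon>0. open U \<and> (0, 0) \<in> U \<and> \<epsilon>0 > 0 \<and>
       (\<forall>\<epsilon> b. 0 < \<bar>\<epsilon>\<bar> \<and> \<bar>\<epsilon>\<bar> < \<epsilon>0 \<and> norm (b - bs) < \<epsilon>0 \<longrightarrow>
          (\<exists>\<^sub>\<le>\<^sub>1\<Gamma>. origin_limit_cycle \<epsilon> b U \<Gamma>))) \<and>
    (\<exists>bs :: params. \<forall>U' \<eta>. open U' \<and> (0, 0) \<in> U' \<and> \<eta> > 0 \<longrightarrow>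
       (\<exists>\<epsilon> b. 0 < \<bar>\<epsilon>\<bar> \<and> \<bar>\<epsilon>\<bar> < \<eta> \<and> norm (b - bs) < \<eta> \<and>
          (\<exists>\<Gamma>. origin_limit_cycle \<epsilon> b U' \<Gamma>)))"
proof (intro conjI)
  show "\<forall>b. is_center (upper_field 0 b) (lower_field 0 b) (0, 0)"
    using is_center_unperturbed by blast
  show "\<forall>bs :: params. \<exists>U \<epsilon>0. open U \<and> (0, 0) \<in> U \<and> \<epsilon>0 > 0 \<and>
       (\<forall>\<epsilon> b. 0 < \<bar>\<epsilon>\<bar> \<and> \<bar>\<epsilon>\<bar> < \<epsilon>0 \<and> norm (b - bs) < \<epsilon>0 \<longrightarrow>
          (\<exists>\<^sub>\<le>\<^sub>1\<Gamma>. origin_limit_cycle \<epsilon> b U \<Gamma>))"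
  proof
    fix bs :: params
    \<comment> \<open>Chosen so that \<bar>\<epsilon>\<bar> * norm b stays below 1/2, using norm b
      \<le> norm bs + 1. The neighbourhood is the same for all bs.\<close>
    define \<epsilon>0 where "\<epsilon>0 = 1 / (2 * (norm bs + 1))"
    have "0 < 1 / (2 * (x + 1)) \<and> 1 / (2 * (x + 1)) \<le> 1 \<and> 1 / (2 * (x + 1)) * (x + 1) = 1/2"
      if "0 \<le> x" for x :: real
      using that by (auto simp: field_simps)
    from this[of "norm bs"] have \<epsilon>0: "0 < \<epsilon>0" "\<epsilon>0 \<le> 1" "\<epsilon>0 * (norm bs + 1) = 1/2"
      by (simp_all only: \<epsilon>0_def norm_ge_zero)
    have "\<exists>\<^sub>\<le>\<^sub>1\<Gamma>. origin_limit_cycle \<epsilon> b (ball 0 (rad / 4)) \<Gamma>"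
      if "\<bar>\<epsilon>\<bar> < \<epsilon>0" "norm (b - bs) < \<epsilon>0" for \<epsilon> b
    proof (rule at_most_one_origin_limit_cycle)
      have "norm b \<le> norm bs + 1" using norm_triangle_sub[of b bs] that \<epsilon>0(2) by linarith
      then have "\<bar>\<epsilon>\<bar> * norm b \<le> \<epsilon>0 * (norm bs + 1)" using that(1) \<epsilon>0(1) by (intro mult_mono) auto
      then show "\<bar>\<epsilon>\<bar> * norm b \<le> 1/2" by (simp only: \<epsilon>0(3))
    qed
    moreover have "(0, 0) \<in> ball (0 :: real \<times> real) (rad / 4)" by (simp add: zero_prod_def[symmetric])
    ultimately show "\<exists>U \<epsilon>0. open U \<and> (0, 0) \<in> U \<and> \<epsilon>0 > 0 \<and>
       (\<forall>\<epsilon> b. 0 < \<bar>\<epsilon>\<bar> \<and> \<bar>\<epsilon>\<bar> < \<epsilon>0 \<and> norm (b - bs) < \<epsilon>0 \<longrightarrow>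
          (\<exists>\<^sub>\<le>\<^sub>1\<Gamma>. origin_limit_cycle \<epsilon> b U \<Gamma>))"
      using \<epsilon>0(1) open_ball by blast
  qed
  show "\<exists>bs :: params. \<forall>U' \<eta>. open U' \<and> (0, 0) \<in> U' \<and> \<eta> > 0 \<longrightarrow>
       (\<exists>\<epsilon> b. 0 < \<bar>\<epsilon>\<bar> \<and> \<bar>\<epsilon>\<bar> < \<eta> \<and> norm (b - bs) < \<eta> \<and>
          (\<exists>\<Gamma>. origin_limit_cycle \<epsilon> b U' \<Gamma>))"
  \<comment> \<open>At this point \<open>p1 - p2\<close> vanishes while \<open>q1 - q2\<close> =
    \<epsilon> does not. A small \<open>p1 - p2\<close> of the opposite sign makes a cycle
    appear.\<close>
  proof (rule exI[of _ "(0, 1, 0, 0)"], intro allI impI)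
    fix U' :: "(real \<times> real) set" and \<eta> :: real
    assume U': "open U' \<and> (0, 0) \<in> U' \<and> 0 < \<eta>"
    then obtain d where d: "0 < d" "ball 0 d \<subseteq> U'"
      unfolding open_contains_ball zero_prod_def by blast
    \<comment> \<open>\<beta> is the distance of b from the base point, hence below \<eta>; 10000 *
      \<beta> \<le> d puts the cycle inside \<open>U'\<close>.\<close>
    define \<beta> where "\<beta> = min (rad / 12000) (min (\<eta> / 2) (d / 10000))"
    define \<epsilon> where "\<epsilon> = min (1/4) (\<eta> / 2)"
    have \<beta>: "0 < \<beta>" "\<beta> \<le> rad / 12000" "\<beta> < \<eta>" "10000 * \<beta> \<le> d"
      using U' d by (auto simp: \<beta>_def min_def)
    have \<epsilon>: "0 < \<epsilon>" "\<epsilon> \<le> 1/4" "\<epsilon> < \<eta>" using U' by (auto simp: \<epsilon>_def)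
    have "ball 0 (10000 * \<beta>) \<subseteq> U'" using d(2) \<beta>(4) subset_ball by blast
    then obtain \<Gamma> where "origin_limit_cycle \<epsilon> (- \<beta>, 1, 0, 0) U' \<Gamma>"
      using origin_limit_cycle_exists[OF \<beta>(1,2) \<epsilon>(1,2)] by blast
    moreover have "norm ((- \<beta>, 1, 0, 0) - (0, 1, 0, 0) :: params) < \<eta>"
      using \<beta> by (simp add: norm_Pair)
    ultimately show "\<exists>\<epsilon> b. 0 < \<bar>\<epsilon>\<bar> \<and> \<bar>\<epsilon>\<bar> < \<eta> \<and> norm (b - (0, 1, 0, 0)) < \<eta> \<and>
          (\<exists>\<Gamma>. origin_limit_cycle \<epsilon> b U' \<Gamma>)"
      using \<epsilon> by (intro exI[of _ \<epsilon>] exI[of _ "(- \<beta>, 1, 0, 0)"]) auto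
  qed
qed

end
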